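(* Fix $n$. For each dimension $d$ let $\mathcal{G}_d$ be the ensemble of $n$-node hard random geometric graphs in $\mathbb{T}^d$ with connection radius $r_0=r_0(d)$ whose nodes $X_1,\dots,X_n$ are independent, with each coordinate of each node independently and uniformly distributed on $[0,1]$. Suppose the limit $t=\lim_{d\to\infty}\left(\frac{r_0(d)^2}{\sqrt d}-\mu_T\sqrt d\right)\in\mathbb{R}$ exists. Then, as $d\to\infty$, $\mathcal{G}_d\to G(n,\bar p(t))$ in distribution, where $$\bar p(t)=\mathbb{P}(Z<t)$$ and $Z\sim N(0,\alpha)$ is a Gaussian random variable with mean zero and variance $\alpha=\mathbb{E}\left[(\rho_T(X_i^1,X_j^1)^2-\mu_T)^2\right]$ for $i\neq j$ ($X_i^1$ being the first coordinate of $X_i$).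
   Context: $\mathbb{T}^d=(\mathbb{R}/\mathbb{Z})^d$ is the unit torus, with points represented by coordinates in $[0,1]$ and metric $\rho_T(x,y)=\sqrt{\sum_{i=1}^d\min(|x_i-y_i|,1-|x_i-y_i|)^2}$; for $d=1$ the same symbol denotes the metric on $\mathbb{T}^1$. A hard random geometric graph with connection radius $r_0$ on a metric space $(\Omega,\rho)$ has vertex set $\{1,\dots,n\}$, random i.i.d. positions $X_1,\dots,X_n\in\Omega$, and an edge $(i,j)$ present if and only if $\rho(X_i,X_j)\le r_0$. The ensemble is the resulting probability distribution on labelled graphs on $\{1,\dots,n\}$. $\mu_T=\int_{[0,1]^2}\rho_T(x,y)^2\,dx\,dy$ is the mean squared distance between two independent uniform points of $\mathbb{T}^1$. $t$ is called the normalised connection range. $G(n,p)$ is the Erdős–Rényi ensemble on $n$ labelled nodes (each edge present independently with probability $p$). A sequence of graph ensembles on $n$ labelled nodes with probability measures $\mathbb{P}_d$ converges in distribution to an ensemble with measure $\mathbb{P}$ if $\mathbb{P}_d(g)\to\mathbb{P}(g)$ for every labelled graph $g$ on $n$ nodes. *)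

theory Defs
  imports "HOL-Probability.Probability"
begin

definition node_pairs :: "nat \<Rightarrow> nat set set" where
  "node_pairs n = {e. e \<subseteq> {1..n} \<and> card e = 2}"

text \<open>A labelled graph on \<open>{1..n}\<close> is identified with its edge set.\<close>

definition labelled_graphs :: "nat \<Rightarrow> nat set set set" where
  "labelled_graphs n = Pow (node_pairs n)"

definition ensembles_converge ::
    "nat \<Rightarrow> (nat \<Rightarrow> nat set set measure) \<Rightarrow> nat set set measure \<Rightarrow> bool" where
  "ensembles_converge n P Q \<longleftrightarrow>
     (\<forall>g \<in> labelled_graphs n. (\<lambda>d. measure (P d) {g}) \<longlonglongrightarrow> measure Q {g})"

text \<open>The argument \<open>x\<close> gives the node positions, \<open>\<rho>\<close> the metric and \<open>r\<close> the connection radius.\<close>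

definition geometric_graph ::
    "nat \<Rightarrow> ('p \<Rightarrow> 'p \<Rightarrow> real) \<Rightarrow> real \<Rightarrow> (nat \<Rightarrow> 'p) \<Rightarrow> nat set set" where
  "geometric_graph n \<rho> r x =
     {{i, j} | i j. i \<in> {1..n} \<and> j \<in> {1..n} \<and> i \<noteq> j \<and> \<rho> (x i) (x j) \<le> r}"

text \<open>The law of the hard random geometric graph with random positions \<open>X 1, \<dots>, X n\<close> on the
  probability space \<open>M\<close>; the joint distribution of the positions is left to the hypotheses
  on \<open>X\<close>.\<close>

definition hard_rgg ::
    "nat \<Rightarrow> ('p \<Rightarrow> 'p \<Rightarrow> real) \<Rightarrow> real \<Rightarrow> 'a measure \<Rightarrow> (nat \<Rightarrow> 'a \<Rightarrow> 'p) \<Rightarrow> nat set set measure"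
  where
  "hard_rgg n \<rho> r M X =
     distr M (count_space (labelled_graphs n)) (\<lambda>\<omega>. geometric_graph n \<rho> r (\<lambda>i. X i \<omega>))"

definition erdos_renyi :: "nat \<Rightarrow> real \<Rightarrow> nat set set pmf" where
  "erdos_renyi n p =
     map_pmf (\<lambda>f. {e \<in> node_pairs n. f e}) (Pi_pmf (node_pairs n) False (\<lambda>_. bernoulli_pmf p))"

text \<open>Points of the torus are given by coordinates in \<open>[0,1]\<close>; a point of the \<open>d\<close>-dimensional torus
  is a function whose values at the indices \<open>1, \<dots>, d\<close> are its coordinates.\<close>

definition circle_dist :: "real \<Rightarrow> real \<Rightarrow> real" where
  "circle_dist x y = min \<bar>x - y\<bar> (1 - \<bar>x - y\<bar>)"

definition torus_dist :: "nat \<Rightarrow> (nat \<Rightarrow> real) \<Rightarrow> (nat \<Rightarrow> real) \<Rightarrow> real" where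
  "torus_dist d x y = sqrt (\<Sum>k=1..d. (circle_dist (x k) (y k))\<^sup>2)"

lemma torus_dist_1:
  assumes "x 1 \<in> {0..1}" "y 1 \<in> {0..1}"
  shows "torus_dist 1 x y = circle_dist (x 1) (y 1)"
  using assms by (auto simp: torus_dist_def circle_dist_def)

definition torus_mean :: real where
  "torus_mean = set_lebesgue_integral lborel ({0..1} \<times> {0..1}) (\<lambda>(x, y). (circle_dist x y)\<^sup>2)"

abbreviation unif01 :: "real measure" where
  "unif01 \<equiv> uniform_measure lborel {0..1}"

text \<open>The expectation is taken under the joint law of two independent uniform points of
  \<open>[0,1]\<close>; lemma \<open>expectation_eq_torus_var\<close> below identifies it with the expectation
  for arbitrary such random variables.\<close>

definition torus_var :: real where
  "torus_var = (\<integral>(x, y). ((circle_dist x y)\<^sup>2 - torus_mean)\<^sup>2 \<partial>(unif01 \<Otimes>\<^sub>M unif01))"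

lemma measurable_circle_dist [measurable]:
  "(\<lambda>(x, y). circle_dist x y) \<in> borel_measurable (borel \<Otimes>\<^sub>M borel)"
  unfolding circle_dist_def by measurable

lemma expectation_eq_torus_var:
  assumes "prob_space M"
    and "prob_space.indep_var M borel U borel V"
    and "distr M borel U = unif01" and "distr M borel V = unif01"
  shows "(\<integral>\<omega>. ((circle_dist (U \<omega>) (V \<omega>))\<^sup>2 - torus_mean)\<^sup>2 \<partial>M) = torus_var"
proof -
  interpret prob_space M by fact
  have [measurable]: "random_variable borel U" "random_variable borel V"
    using assms(2) by (auto dest: indep_var_rv1 indep_var_rv2)
  have "unif01 \<Otimes>\<^sub>M unif01 = distr M (borel \<Otimes>\<^sub>M borel) (\<lambda>\<omega>. (U \<omega>, V \<omega>))"
    using assms by (simp add: indep_var_distribution_eq)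
  moreover have "(\<lambda>(x, y). ((circle_dist x y)\<^sup>2 - torus_mean)\<^sup>2) \<in> borel_measurable (borel \<Otimes>\<^sub>M borel)"
    unfolding circle_dist_def by measurable
  ultimately show ?thesis
    unfolding torus_var_def by (simp add: integral_distr)
qed

lemma finite_node_pairs: "finite (node_pairs n)"
  by (rule finite_subset[of _ "Pow {1..n}"]) (auto simp: node_pairs_def)

lemma geometric_graph_in_labelled_graphs: "geometric_graph n \<rho> r x \<in> labelled_graphs n"
  by (auto simp: geometric_graph_def labelled_graphs_def node_pairs_def)

lemma measurable_geometric_graph:
  assumes [measurable]: "\<And>i j. i \<in> {1..n} \<Longrightarrow> j \<in> {1..n} \<Longrightarrow>
      (\<lambda>\<omega>. \<rho> (X i \<omega>) (X j \<omega>)) \<in> borel_measurable M"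
  shows "(\<lambda>\<omega>. geometric_graph n \<rho> r (\<lambda>i. X i \<omega>)) \<in> M \<rightarrow>\<^sub>M count_space (labelled_graphs n)"
proof (subst measurable_count_space_eq2)
  show "finite (labelled_graphs n)"
    by (simp add: labelled_graphs_def finite_node_pairs)
  let ?G = "\<lambda>\<omega>. geometric_graph n \<rho> r (\<lambda>i. X i \<omega>)"
  have edge: "{\<omega> \<in> space M. e \<in> ?G \<omega>} \<in> sets M" for e
  proof -
    have "{\<omega> \<in> space M. e \<in> ?G \<omega>} =
        (\<Union>i\<in>{1..n}. \<Union>j\<in>{1..n}. {\<omega> \<in> space M. (i \<noteq> j \<and> e = {i, j}) \<and> \<rho> (X i \<omega>) (X j \<omega>) \<le> r})"
      unfolding geometric_graph_def by blast
    also have "\<dots> \<in> sets M"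
      by (intro sets.finite_UN) auto
    finally show ?thesis .
  qed
  have "?G -` {g} \<inter> space M \<in> sets M" if "g \<in> labelled_graphs n" for g
  proof -
    have "?G -` {g} \<inter> space M = {\<omega> \<in> space M. \<forall>e\<in>node_pairs n. (e \<in> ?G \<omega>) = (e \<in> g)}"
    proof -
      have "?G \<omega> = g \<longleftrightarrow> (\<forall>e\<in>node_pairs n. (e \<in> ?G \<omega>) = (e \<in> g))" for \<omega>
        using geometric_graph_in_labelled_graphs[of n \<rho> r "\<lambda>i. X i \<omega>"] that
        unfolding labelled_graphs_def by blast
      then show ?thesis
        by blast
    qed
    also have "\<dots> \<in> sets M"
    proof (intro sets.sets_Collect_finite_All finite_node_pairs)
      fix e
      show "{\<omega> \<in> space M. (e \<in> ?G \<omega>) = (e \<in> g)} \<in> sets M"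
      proof (cases "e \<in> g")
        case True
        then show ?thesis using edge[of e] by simp
      next
        case False
        then show ?thesis using sets.sets_Collect_neg[OF edge[of e]] by simp
      qed
    qed
    finally show ?thesis .
  qed
  then show "?G \<in> space M \<rightarrow> labelled_graphs n \<and>
      (\<forall>a\<in>labelled_graphs n. ?G -` {a} \<inter> space M \<in> sets M)"
    using geometric_graph_in_labelled_graphs by auto
qed

lemma prob_space_hard_rgg_torus:
  assumes "prob_space M"
    and "\<And>i k. i \<in> {1..n} \<Longrightarrow> k \<in> {1..d} \<Longrightarrow> (\<lambda>\<omega>. X i \<omega> k) \<in> borel_measurable M"
  shows "prob_space (hard_rgg n (torus_dist d) r M X)"
  unfolding hard_rgg_def
proof (intro prob_space.prob_space_distr assms(1) measurable_geometric_graph)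
  fix i j assume "i \<in> {1..n}" "j \<in> {1..n}"
  then have [measurable]: "(\<lambda>\<omega>. X i \<omega> k) \<in> borel_measurable M" "(\<lambda>\<omega>. X j \<omega> k) \<in> borel_measurable M"
    if "k \<in> {1..d}" for k
    using assms(2) that by auto
  show "(\<lambda>\<omega>. torus_dist d (X i \<omega>) (X j \<omega>)) \<in> borel_measurable M"
    unfolding torus_dist_def circle_dist_def by measurable
qed

end

theory Submission
  imports Defs
begin

text \<open>The edge \<open>{i, j}\<close> is present iff the normalised sum over the coordinates of the centred
  squared circle distances is at most \<open>r\<^sub>0\<^sup>2 / sqrt d - \<mu> * sqrt d\<close>, which tends to \<open>t\<close>. The coordinates
  are independent, and within one coordinate the deviations of distinct edges are uncorrelated, since
  the distance between two uniform points of the circle is independent of either endpoint. So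
  every linear combination of the edge sums has a Gaussian limit with diagonal covariance. The joint
  limit law follows from the one-dimensional Levy continuity theorem by
  exchanging, one edge at a time, a factor \<open>exp (i u S)\<close> of the joint characteristic function for
  the indicator of an event on \<open>S\<close>.\<close>

section \<open>Joint weak convergence from characteristic functions\<close>

text \<open>Within one coordinate the deviations of distinct edges are uncorrelated but not
  independent: the three edges of a triangle constrain each other. Independence appears only in the
  limit, where vanishing covariance becomes a factorised characteristic function. The obstacle in
  passing from there to probabilities is that factors kept in exponential form are complex weights,
  not densities; the real and imaginary parts are bounded, so a constant shift repairs this.

  The node positions live on a different probability space for each \<open>d\<close>. Only
  characteristic functions are carried over: that of the sum over coordinates is the
  \<open>d\<close>-th power of a fixed one, up to a phase, and such powers also arise from
  independent copies on one infinite product space, where the classical central limit theorem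
  applies.

  The boundary point \<open>t\<close> has Gaussian measure 0. This makes the half-lines continuity
  sets and reconciles the closed condition on edges with the strict inequality in the limit.\<close>

lemma weighted_weak_conv_pos:
  fixes W T :: "nat \<Rightarrow> 'a \<Rightarrow> real"
  assumes M: "\<And>d. prob_space (M d)"
    and W [measurable]: "\<And>d. W d \<in> borel_measurable (M d)"
    and T [measurable]: "\<And>d. T d \<in> borel_measurable (M d)"
    and bounds: "\<And>d \<omega>. 1 \<le> W d \<omega>" "\<And>d \<omega>. W d \<omega> \<le> K"
    and "real_distribution \<nu>"
    and cf: "\<And>u. (\<lambda>d. \<integral>\<omega>. W d \<omega> *\<^sub>R iexp (u * T d \<omega>) \<partial>M d) \<longlonglongrightarrow> of_real w * char \<nu> u"
    and A [measurable]: "A \<in> sets borel" and frontier: "measure \<nu> (frontier A) = 0"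
  shows "(\<lambda>d. \<integral>\<omega>. W d \<omega> * indicator A (T d \<omega>) \<partial>M d) \<longlonglongrightarrow> w * measure \<nu> A"
proof -
  interpret M: prob_space "M d" for d by (rule M)
  interpret \<nu>: real_distribution \<nu> by fact
  have int: "integrable (M d) (W d)" for d
    using bounds by (intro M.integrable_const_bound[where B=K] AE_I2)
      (simp_all, smt (verit, best))
  define z where "z d = (\<integral>\<omega>. W d \<omega> \<partial>M d)" for d
  \<comment> \<open>The lower bound 1 on the weight keeps the normalising constants, and hence their
    limit, away from 0, so that both can be divided by.\<close>
  have z1: "1 \<le> z d" for d
  proof -
    have "(\<integral>\<omega>. 1 \<partial>M d) \<le> z d"
      unfolding z_def by (intro integral_mono int bounds) auto
    then show ?thesis by (simp add: M.prob_space)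
  qed
  have "(\<lambda>d. complex_of_real (z d)) \<longlonglongrightarrow> of_real w"
    using cf[of 0] by (simp add: z_def \<nu>.char_zero scaleR_conv_of_real)
  then have zw: "z \<longlonglongrightarrow> w"
    using tendsto_of_real_iff by blast
  have w1: "1 \<le> w"
    by (rule LIMSEQ_le_const[OF zw]) (use z1 in auto)
  \<comment> \<open>Under the tilted measure \<open>D d\<close> the characteristic function of
    \<open>T d\<close> is the weighted integral divided by \<open>z d\<close>, so the continuity
    theorem turns the hypothesis on weighted integrals into weak convergence.\<close>
  define D where "D d = density (M d) (\<lambda>\<omega>. ennreal (W d \<omega> / z d))" for d
  have pos: "0 \<le> W d \<omega> / z d" for d \<omega>
    using bounds(1)[of d \<omega>] z1[of d] by simp
  have D: "prob_space (D d)" for d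
  proof (rule prob_spaceI)
    have "emeasure (D d) (space (D d)) = (\<integral>\<^sup>+\<omega>. ennreal (W d \<omega> / z d) \<partial>M d)"
      unfolding D_def by (simp add: emeasure_density cong: nn_integral_cong_simp)
    also have "\<dots> = ennreal (\<integral>\<omega>. W d \<omega> / z d \<partial>M d)"
      using pos int by (intro nn_integral_eq_integral) auto
    also have "\<dots> = 1"
      using z1[of d] by (simp add: z_def[symmetric])
    finally show "emeasure (D d) (space (D d)) = 1" .
  qed
  define R where "R d = distr (D d) borel (T d)" for d
  have TD [measurable]: "T d \<in> borel_measurable (D d)" for d
    by (simp add: D_def)
  have R: "real_distribution (R d)" for d
    unfolding R_def by (rule prob_space.real_distribution_distr[OF D]) simp
  have int_R: "(\<integral>x. f x \<partial>R d) = (\<integral>\<omega>. (W d \<omega> / z d) *\<^sub>R f (T d \<omega>) \<partial>M d)"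
    if [measurable]: "f \<in> borel_measurable borel" for f :: "real \<Rightarrow> 'c::{banach,second_countable_topology}" and d
    unfolding R_def using pos
    by (subst integral_distr) (auto simp: D_def integral_density)
  have "weak_conv_m R \<nu>"
  proof (rule levy_continuity[OF R \<open>real_distribution \<nu>\<close>])
    fix u
    have "char (R d) u = (\<integral>\<omega>. W d \<omega> *\<^sub>R iexp (u * T d \<omega>) \<partial>M d) / of_real (z d)" for d
      unfolding char_def
      by (subst int_R) (auto simp: scaleR_conv_of_real)
    moreover have "(\<lambda>d. (\<integral>\<omega>. W d \<omega> *\<^sub>R iexp (u * T d \<omega>) \<partial>M d) / of_real (z d))
        \<longlonglongrightarrow> of_real w * char \<nu> u / of_real w"
      using w1 by (intro tendsto_divide cf tendsto_of_real zw) auto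
    ultimately show "(\<lambda>d. char (R d) u) \<longlonglongrightarrow> char \<nu> u"
      using w1 by simp
  qed
  then have "(\<lambda>d. measure (R d) A) \<longlonglongrightarrow> measure \<nu> A"
    using frontier by (intro weak_conv_imp_continuity_set_conv[OF R \<open>real_distribution \<nu>\<close>])
      (auto simp: \<nu>.emeasure_eq_measure)
  then have "(\<lambda>d. z d * measure (R d) A) \<longlonglongrightarrow> w * measure \<nu> A"
    by (intro tendsto_mult zw)
  moreover have "z d * measure (R d) A = (\<integral>\<omega>. W d \<omega> * indicator A (T d \<omega>) \<partial>M d)" for d
  proof -
    have "measure (R d) A = (\<integral>x. indicator A x \<partial>R d)"
      by (simp add: R_def)
    also have "\<dots> = (\<integral>\<omega>. W d \<omega> * indicator A (T d \<omega>) \<partial>M d) / z d"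
      by (subst int_R) auto
    finally show ?thesis
      using z1[of d] by simp
  qed
  ultimately show ?thesis
    by simp
qed

text \<open>The shifted weight \<open>2 + W\<close> is positive, so it defines a change of measure to which the
  continuity theorem applies; its limit is that of \<open>W\<close> plus twice the unweighted one.\<close>

lemma weighted_weak_conv_real:
  fixes W T :: "nat \<Rightarrow> 'a \<Rightarrow> real"
  assumes M: "\<And>d. prob_space (M d)"
    and W [measurable]: "\<And>d. W d \<in> borel_measurable (M d)"
    and T [measurable]: "\<And>d. T d \<in> borel_measurable (M d)"
    and bound: "\<And>d \<omega>. \<bar>W d \<omega>\<bar> \<le> 1"
    and \<nu>: "real_distribution \<nu>"
    and cf1: "\<And>u. (\<lambda>d. \<integral>\<omega>. iexp (u * T d \<omega>) \<partial>M d) \<longlonglongrightarrow> char \<nu> u"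
    and cf: "\<And>u. (\<lambda>d. \<integral>\<omega>. W d \<omega> *\<^sub>R iexp (u * T d \<omega>) \<partial>M d) \<longlonglongrightarrow> of_real w * char \<nu> u"
    and A [measurable]: "A \<in> sets borel" and frontier: "measure \<nu> (frontier A) = 0"
  shows "(\<lambda>d. \<integral>\<omega>. W d \<omega> * indicator A (T d \<omega>) \<partial>M d) \<longlonglongrightarrow> w * measure \<nu> A"
proof -
  interpret M: prob_space "M d" for d by (rule M)
  have int: "integrable (M d) (\<lambda>\<omega>. W d \<omega> *\<^sub>R iexp (u * T d \<omega>))" for d u
    using bound by (intro M.integrable_const_bound[where B=1]) auto
  have int1: "integrable (M d) (\<lambda>\<omega>. iexp (u * T d \<omega>))" for d u
    by (rule M.integrable_iexp) auto
  have ind: "integrable (M d) (\<lambda>\<omega>. W d \<omega> * indicator A (T d \<omega>))"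
    "integrable (M d) (\<lambda>\<omega>. indicator A (T d \<omega>) :: real)" for d
    using bound by (auto intro!: M.integrable_const_bound[where B=1] simp: indicator_def)
  \<comment> \<open>With values of \<open>W\<close> in [-1, 1], the least shift that guarantees a
    weight of at least 1 is 2, and the upper bound is then 3.\<close>
  have "(\<lambda>d. \<integral>\<omega>. (2 + W d \<omega>) * indicator A (T d \<omega>) \<partial>M d) \<longlonglongrightarrow> (2 + w) * measure \<nu> A"
  proof (rule weighted_weak_conv_pos[OF M _ T _ _ \<nu> _ A frontier, where K=3])
    fix u
    have "(\<integral>\<omega>. (2 + W d \<omega>) *\<^sub>R iexp (u * T d \<omega>) \<partial>M d) =
        2 * (\<integral>\<omega>. iexp (u * T d \<omega>) \<partial>M d) + (\<integral>\<omega>. W d \<omega> *\<^sub>R iexp (u * T d \<omega>) \<partial>M d)" for d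
      unfolding scaleR_add_left using int[of d u] int1[of d u]
      by (subst Bochner_Integration.integral_add) (auto simp: scaleR_conv_of_real)
    then show "(\<lambda>d. \<integral>\<omega>. (2 + W d \<omega>) *\<^sub>R iexp (u * T d \<omega>) \<partial>M d)
        \<longlonglongrightarrow> of_real (2 + w) * char \<nu> u"
      using tendsto_add[OF tendsto_mult[OF tendsto_const cf1[of u]] cf[of u], of 2]
      by (simp add: distrib_right)
  next
    show "1 \<le> 2 + W d \<omega>" "2 + W d \<omega> \<le> 3" for d \<omega>
      using bound[of d \<omega>] by auto
  qed auto
  moreover have "(\<lambda>d. \<integral>\<omega>. 1 * indicator A (T d \<omega>) \<partial>M d) \<longlonglongrightarrow> 1 * measure \<nu> A"
    using cf1 by (intro weighted_weak_conv_pos[OF M _ T _ _ \<nu> _ A frontier, where K=1]) auto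
  ultimately have "(\<lambda>d. (\<integral>\<omega>. (2 + W d \<omega>) * indicator A (T d \<omega>) \<partial>M d)
      - 2 * (\<integral>\<omega>. 1 * indicator A (T d \<omega>) \<partial>M d)) \<longlonglongrightarrow> (2 + w) * measure \<nu> A - 2 * (1 * measure \<nu> A)"
    by (intro tendsto_diff tendsto_mult_left)
  moreover have "(\<integral>\<omega>. (2 + W d \<omega>) * indicator A (T d \<omega>) \<partial>M d)
      - 2 * (\<integral>\<omega>. 1 * indicator A (T d \<omega>) \<partial>M d) = (\<integral>\<omega>. W d \<omega> * indicator A (T d \<omega>) \<partial>M d)" for d
    unfolding distrib_right using ind[of d]
    by (subst Bochner_Integration.integral_add) auto
  ultimately show ?thesis
    by (simp add: algebra_simps)
qed

text \<open>The real and imaginary parts of the weight are combinations of \<open>W\<close> and its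
  conjugate, so the limits for these two feed the case of a real weight twice, with limiting masses
  \<open>Re w\<close> and \<open>Im w\<close>. The indicator is real and does not mix the
  parts.\<close>

lemma weighted_weak_conv:
  fixes W :: "nat \<Rightarrow> 'a \<Rightarrow> complex" and T :: "nat \<Rightarrow> 'a \<Rightarrow> real"
  assumes M: "\<And>d. prob_space (M d)"
    and W [measurable]: "\<And>d. W d \<in> borel_measurable (M d)"
    and T [measurable]: "\<And>d. T d \<in> borel_measurable (M d)"
    and bound: "\<And>d \<omega>. cmod (W d \<omega>) \<le> 1"
    and \<nu>: "real_distribution \<nu>"
    and cf1: "\<And>u. (\<lambda>d. \<integral>\<omega>. iexp (u * T d \<omega>) \<partial>M d) \<longlonglongrightarrow> char \<nu> u"
    and cf: "\<And>u. (\<lambda>d. \<integral>\<omega>. W d \<omega> * iexp (u * T d \<omega>) \<partial>M d) \<longlonglongrightarrow> w * char \<nu> u"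
    and cfc: "\<And>u. (\<lambda>d. \<integral>\<omega>. cnj (W d \<omega>) * iexp (u * T d \<omega>) \<partial>M d) \<longlonglongrightarrow> cnj w * char \<nu> u"
    and A [measurable]: "A \<in> sets borel" and frontier: "measure \<nu> (frontier A) = 0"
  shows "(\<lambda>d. \<integral>\<omega>. W d \<omega> * indicator A (T d \<omega>) \<partial>M d) \<longlonglongrightarrow> w * measure \<nu> A"
proof -
  interpret M: prob_space "M d" for d by (rule M)
  have [measurable]: "(\<lambda>\<omega>. cnj (W d \<omega>)) \<in> borel_measurable (M d)" for d
    using borel_measurable_continuous_onI[OF continuous_on_cnj[OF continuous_on_id]] W measurable_compose by blast
  have int: "integrable (M d) (\<lambda>\<omega>. W d \<omega> * iexp (u * T d \<omega>))"
     "integrable (M d) (\<lambda>\<omega>. cnj (W d \<omega>) * iexp (u * T d \<omega>))" for d u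
    using bound by (auto intro!: M.integrable_const_bound[where B=1] simp: norm_mult)
  have ind: "integrable (M d) (\<lambda>\<omega>. W d \<omega> * indicator A (T d \<omega>))" for d
    using bound by (auto intro!: M.integrable_const_bound[where B=1] simp: indicator_def)
  have re: "(\<lambda>d. \<integral>\<omega>. Re (W d \<omega>) * indicator A (T d \<omega>) \<partial>M d) \<longlonglongrightarrow> Re w * measure \<nu> A"
  proof (rule weighted_weak_conv_real[OF M _ T _ \<nu> cf1 _ A frontier])
    fix u
    have "(\<integral>\<omega>. Re (W d \<omega>) *\<^sub>R iexp (u * T d \<omega>) \<partial>M d) =
      ((\<integral>\<omega>. W d \<omega> * iexp (u * T d \<omega>) \<partial>M d) + (\<integral>\<omega>. cnj (W d \<omega>) * iexp (u * T d \<omega>) \<partial>M d)) / 2" for d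
      by (subst Bochner_Integration.integral_add[symmetric, OF int], subst integral_divide_zero[symmetric])
         (intro Bochner_Integration.integral_cong refl,
          simp add: scaleR_conv_of_real complex_add_cnj distrib_right[symmetric])
    moreover have "complex_of_real (Re w) * char \<nu> u = (w * char \<nu> u + cnj w * char \<nu> u) / 2"
      by (simp add: distrib_right[symmetric] complex_add_cnj)
    ultimately show "(\<lambda>d. \<integral>\<omega>. Re (W d \<omega>) *\<^sub>R iexp (u * T d \<omega>) \<partial>M d)
        \<longlonglongrightarrow> of_real (Re w) * char \<nu> u"
      using tendsto_divide[OF tendsto_add[OF cf[of u] cfc[of u]] tendsto_const, of 2] by (simp only:) simp
  next
    show "\<bar>Re (W d \<omega>)\<bar> \<le> 1" for d \<omega>
      using abs_Re_le_cmod bound by (rule order_trans)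
  qed auto
  have im: "(\<lambda>d. \<integral>\<omega>. Im (W d \<omega>) * indicator A (T d \<omega>) \<partial>M d) \<longlonglongrightarrow> Im w * measure \<nu> A"
  proof (rule weighted_weak_conv_real[OF M _ T _ \<nu> cf1 _ A frontier])
    fix u
    have "(\<integral>\<omega>. Im (W d \<omega>) *\<^sub>R iexp (u * T d \<omega>) \<partial>M d) =
      ((\<integral>\<omega>. W d \<omega> * iexp (u * T d \<omega>) \<partial>M d) - (\<integral>\<omega>. cnj (W d \<omega>) * iexp (u * T d \<omega>) \<partial>M d)) / (2 * \<i>)" for d
      by (subst Bochner_Integration.integral_diff[symmetric, OF int], subst integral_divide_zero[symmetric])
         (intro Bochner_Integration.integral_cong refl,
          simp add: scaleR_conv_of_real complex_diff_cnj left_diff_distrib[symmetric] mult_ac)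
    moreover have "complex_of_real (Im w) * char \<nu> u = (w * char \<nu> u - cnj w * char \<nu> u) / (2 * \<i>)"
      by (simp add: left_diff_distrib[symmetric] complex_diff_cnj mult_ac)
    ultimately show "(\<lambda>d. \<integral>\<omega>. Im (W d \<omega>) *\<^sub>R iexp (u * T d \<omega>) \<partial>M d)
        \<longlonglongrightarrow> of_real (Im w) * char \<nu> u"
      using tendsto_divide[OF tendsto_diff[OF cf[of u] cfc[of u]] tendsto_const, of "2 * \<i>"] by (simp only:) simp
  next
    show "\<bar>Im (W d \<omega>)\<bar> \<le> 1" for d \<omega>
      using abs_Im_le_cmod bound by (rule order_trans)
  qed auto
  have "Re (W d \<omega> * indicator A (T d \<omega>)) = Re (W d \<omega>) * indicator A (T d \<omega>)"
    "Im (W d \<omega> * indicator A (T d \<omega>)) = Im (W d \<omega>) * indicator A (T d \<omega>)" for d \<omega>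
    by (auto simp: indicator_def)
  then have "Re (\<integral>\<omega>. W d \<omega> * indicator A (T d \<omega>) \<partial>M d) = (\<integral>\<omega>. Re (W d \<omega>) * indicator A (T d \<omega>) \<partial>M d)"
    "Im (\<integral>\<omega>. W d \<omega> * indicator A (T d \<omega>) \<partial>M d) = (\<integral>\<omega>. Im (W d \<omega>) * indicator A (T d \<omega>) \<partial>M d)" for d
    using integral_Re[OF ind[of d]] integral_Im[OF ind[of d]] by simp_all
  with re im show ?thesis
    by (simp add: tendsto_complex_iff)
qed

text \<open>Convergence to a product law, tested on boxes whose sides have null boundary. Each side
  is handled by a one-dimensional limit in which the other factors form a bounded complex
  weight.\<close>

lemma joint_prob_tendsto:
  fixes S :: "nat \<Rightarrow> 'e \<Rightarrow> 'a \<Rightarrow> real" and \<nu> :: "'e \<Rightarrow> real measure"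
  assumes M: "\<And>d. prob_space (M d)"
    and E: "finite E"
    and S [measurable]: "\<And>d e. e \<in> E \<Longrightarrow> S d e \<in> borel_measurable (M d)"
    and \<nu>: "\<And>e. e \<in> E \<Longrightarrow> real_distribution (\<nu> e)"
    and cf: "\<And>u. (\<lambda>d. \<integral>\<omega>. iexp (\<Sum>e\<in>E. u e * S d e \<omega>) \<partial>M d) \<longlonglongrightarrow> (\<Prod>e\<in>E. char (\<nu> e) (u e))"
    and B [measurable]: "\<And>e. e \<in> E \<Longrightarrow> B e \<in> sets borel"
    and frontier: "\<And>e. e \<in> E \<Longrightarrow> measure (\<nu> e) (frontier (B e)) = 0"
  shows "(\<lambda>d. measure (M d) {\<omega> \<in> space (M d). \<forall>e\<in>E. S d e \<omega> \<in> B e}) \<longlonglongrightarrow> (\<Prod>e\<in>E. measure (\<nu> e) (B e))"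
proof -
  interpret M: prob_space "M d" for d by (rule M)
  define J where "J d F \<omega> = (\<Prod>e\<in>F. indicator (B e) (S d e \<omega>) :: complex)" for d F \<omega>
  have J_eq: "J d F \<omega> = (if \<forall>e\<in>F. S d e \<omega> \<in> B e then 1 else 0)" if "finite F" for d F \<omega>
    using that by (auto simp: J_def indicator_def)
  \<comment> \<open>Zero frequencies outside \<open>G\<close> remove those factors on both sides, as
    \<open>char\<close> is 1 at 0.\<close>
  have cfG: "(\<lambda>d. \<integral>\<omega>. iexp (\<Sum>e\<in>G. u e * S d e \<omega>) \<partial>M d) \<longlonglongrightarrow> (\<Prod>e\<in>G. char (\<nu> e) (u e))"
    if "G \<subseteq> E" for G u
  proof -
    let ?u = "\<lambda>e. if e \<in> G then u e else 0"
    have "(\<Sum>e\<in>E. ?u e * S d e \<omega>) = (\<Sum>e\<in>G. u e * S d e \<omega>)" for d \<omega>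
      using that E by (intro sum.mono_neutral_cong_right) auto
    moreover have "(\<Prod>e\<in>E. char (\<nu> e) (?u e)) = (\<Prod>e\<in>G. char (\<nu> e) (u e))"
      using that E \<nu> by (intro prod.mono_neutral_cong_right) (auto simp: real_distribution.char_zero)
    ultimately show ?thesis
      using cf[of ?u] by simp
  qed
  \<comment> \<open>\<open>F\<close> holds the indices already turned into indicators,
    \<open>G\<close> those still in exponential form. \<open>G\<close> and \<open>u\<close> stay
    general because the induction step uses the hypothesis for \<open>insert f G\<close> with a new
    frequency at \<open>f\<close>.\<close>
  have main: "(\<lambda>d. \<integral>\<omega>. J d F \<omega> * iexp (\<Sum>e\<in>G. u e * S d e \<omega>) \<partial>M d)
      \<longlonglongrightarrow> of_real (\<Prod>e\<in>F. measure (\<nu> e) (B e)) * (\<Prod>e\<in>G. char (\<nu> e) (u e))"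
    if "finite F" "F \<subseteq> E" "G \<subseteq> E" "F \<inter> G = {}" for F G u
    using that
  proof (induction F arbitrary: G u rule: finite_induct)
    case empty
    then show ?case using cfG by (simp add: J_def)
  next
    case (insert f F)
    then have f: "f \<in> E" "f \<notin> F" "f \<notin> G" "F \<subseteq> E" "finite F" "finite G"
      using E finite_subset by auto
    have [measurable]: "S d f \<in> borel_measurable (M d)" for d
      using f by simp
    have J_meas [measurable]: "(\<lambda>\<omega>. J d F \<omega>) \<in> borel_measurable (M d)" for d
      unfolding J_def using f by (intro borel_measurable_prod measurable_compose[OF S]) auto
    have S_meas [measurable]: "(\<lambda>\<omega>. \<Sum>e\<in>G. u e * S d e \<omega>) \<in> borel_measurable (M d)" for d u
      using insert.prems by (intro borel_measurable_sum borel_measurable_times S) auto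
    let ?W = "\<lambda>d \<omega>. J d F \<omega> * iexp (\<Sum>e\<in>G. u e * S d e \<omega>)"
    let ?p = "\<Prod>e\<in>F. measure (\<nu> e) (B e)"
    \<comment> \<open>The exponential factor of \<open>f\<close>, with free frequency
      \<open>x\<close>, is split off. Updating \<open>v\<close> at \<open>f\<close> leaves the sum
      over \<open>G\<close> unchanged, as \<open>f\<close> is not in \<open>G\<close>.\<close>
    have IH: "(\<lambda>d. \<integral>\<omega>. (J d F \<omega> * iexp (\<Sum>e\<in>G. v e * S d e \<omega>)) * iexp (x * S d f \<omega>) \<partial>M d)
      \<longlonglongrightarrow> (of_real ?p * (\<Prod>e\<in>G. char (\<nu> e) (v e))) * char (\<nu> f) x" for v x
    proof -
      have "(\<Sum>e\<in>G. (v(f:=x)) e * S d e \<omega>) = (\<Sum>e\<in>G. v e * S d e \<omega>)" for d \<omega>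
        using f by (intro sum.cong) auto
      moreover have "(\<Prod>e\<in>G. char (\<nu> e) ((v(f:=x)) e)) = (\<Prod>e\<in>G. char (\<nu> e) (v e))"
        using f by (intro prod.cong) auto
      ultimately show ?thesis
        using insert.IH[of "insert f G" "v(f:=x)"] insert.prems f
        by (simp add: distrib_left exp_add mult_ac del: fun_upd_apply) (simp add: mult_ac)
    qed
    have cnj_J: "cnj (J d F \<omega>) = J d F \<omega>" for d \<omega>
      using f by (simp add: J_eq)
    have cnj_exp: "cnj (iexp y) = iexp (- y)" for y
      by (simp add: exp_cnj)
    have cnj_char: "cnj (char N y) = char N (- y)" for N y
    proof -
      have "char N (- y) = (\<integral>x. cnj (iexp (y * x)) \<partial>N)"
        by (simp add: char_def exp_cnj del: Bochner_Integration.integral_cnj)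
      then show ?thesis
        using Bochner_Integration.integral_cnj[of N "\<lambda>x. iexp (y * x)"] by (simp only: char_def)
    qed
    have "(\<lambda>d. \<integral>\<omega>. ?W d \<omega> * indicator (B f) (S d f \<omega>) \<partial>M d)
      \<longlonglongrightarrow> (of_real ?p * (\<Prod>e\<in>G. char (\<nu> e) (u e))) * measure (\<nu> f) (B f)"
    proof (rule weighted_weak_conv[OF M])
      show "?W d \<in> borel_measurable (M d)" for d
        by measurable
      show "cmod (?W d \<omega>) \<le> 1" for d \<omega>
        using f by (simp add: norm_mult J_eq)
      show "(\<lambda>d. \<integral>\<omega>. iexp (x * S d f \<omega>) \<partial>M d) \<longlonglongrightarrow> char (\<nu> f) x" for x
        using cfG[of "{f}" "\<lambda>_. x"] f by simp
      \<comment> \<open>The indicators are real, so conjugating the weight only reverses the signs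
        of the frequencies; the limit is the induction hypothesis at \<open>- u\<close>.\<close>
      show "(\<lambda>d. \<integral>\<omega>. cnj (?W d \<omega>) * iexp (x * S d f \<omega>) \<partial>M d)
        \<longlonglongrightarrow> cnj (of_real ?p * (\<Prod>e\<in>G. char (\<nu> e) (u e))) * char (\<nu> f) x" for x
        using IH[of "\<lambda>e. - u e" x]
        by (simp only: complex_cnj_mult cnj_J cnj_exp cnj_char cnj_prod sum_negf mult_minus_left
            complex_cnj_complex_of_real)
      show "(\<lambda>d. \<integral>\<omega>. ?W d \<omega> * iexp (x * S d f \<omega>) \<partial>M d)
        \<longlonglongrightarrow> of_real ?p * (\<Prod>e\<in>G. char (\<nu> e) (u e)) * char (\<nu> f) x" for x
        by (rule IH)
    qed (use f \<nu> B frontier in auto)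
    moreover have "?W d \<omega> * indicator (B f) (S d f \<omega>) = J d (insert f F) \<omega> * iexp (\<Sum>e\<in>G. u e * S d e \<omega>)" for d \<omega>
      using f by (simp add: J_def mult_ac)
    ultimately have "(\<lambda>d. \<integral>\<omega>. J d (insert f F) \<omega> * iexp (\<Sum>e\<in>G. u e * S d e \<omega>) \<partial>M d)
      \<longlonglongrightarrow> (of_real ?p * (\<Prod>e\<in>G. char (\<nu> e) (u e))) * measure (\<nu> f) (B f)"
      by (simp only:)
    then show ?case
      using f by (simp add: mult_ac)
  qed
  have meas: "{\<omega> \<in> space (M d). \<forall>e\<in>E. S d e \<omega> \<in> B e} \<in> sets (M d)" for d
    using E S B by (intro sets.sets_Collect_finite_All) (auto intro: measurable_sets_Collect)
  have "(\<integral>\<omega>. J d E \<omega> \<partial>M d) = of_real (measure (M d) {\<omega> \<in> space (M d). \<forall>e\<in>E. S d e \<omega> \<in> B e})" for d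
  proof -
    let ?A = "{\<omega> \<in> space (M d). \<forall>e\<in>E. S d e \<omega> \<in> B e}"
    have "(\<integral>\<omega>. J d E \<omega> \<partial>M d) = (\<integral>\<omega>. complex_of_real (indicator ?A \<omega>) \<partial>M d)"
      using E by (intro Bochner_Integration.integral_cong) (auto simp: J_eq indicator_def)
    also have "\<dots> = of_real (measure (M d) ?A)"
      using meas[of d] by simp
    finally show ?thesis .
  qed
  with main[of E "{}"] E
  have "(\<lambda>d. complex_of_real (measure (M d) {\<omega> \<in> space (M d). \<forall>e\<in>E. S d e \<omega> \<in> B e}))
      \<longlonglongrightarrow> complex_of_real (\<Prod>e\<in>E. measure (\<nu> e) (B e))"
    by (simp del: of_real_prod)
  then show ?thesis
    by (simp only: tendsto_of_real_iff)
qed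

section \<open>A central limit theorem for powers of characteristic functions\<close>

text \<open>Restriction to \<open>I\<close> fixes every point of the product space, so the joint law
  of the coordinates is the product measure, which is also the product of its marginals.\<close>

lemma indep_vars_PiM_coordinates:
  assumes M: "\<And>i. i \<in> I \<Longrightarrow> prob_space (M i)"
  shows "prob_space.indep_vars (PiM I M) M (\<lambda>i x. x i) I"
proof -
  interpret P: prob_space "PiM I M" by (rule prob_space_PiM[OF M])
  show ?thesis
  proof (cases "I = {}")
    case True
    then show ?thesis
      unfolding P.indep_vars_def P.indep_sets_def by auto
  next
    case False
    have "distr (PiM I M) (PiM I M) (\<lambda>x. \<lambda>i\<in>I. x i) = distr (PiM I M) (PiM I M) (\<lambda>x. x)"
      by (intro distr_cong refl) (auto simp: space_PiM)
    also have "\<dots> = (\<Pi>\<^sub>M i\<in>I. distr (PiM I M) (M i) (\<lambda>x. x i))"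
      using distr_PiM_component[of I M] M by (simp add: distr_id2 cong: PiM_cong)
    finally show ?thesis
      using False by (subst P.indep_vars_iff_distr_eq_PiM') auto
  qed
qed

text \<open>The power is the characteristic function of a sum of \<open>d\<close> independent copies
  divided by \<open>sqrt d\<close>. Realising the copies as coordinates of an infinite product
  reduces the claim to the central limit theorem, read off at a single argument.\<close>

lemma char_power_tendsto:
  assumes \<mu>: "real_distribution \<mu>"
    and int: "integrable \<mu> (\<lambda>x. x\<^sup>2)"
    and mean: "(\<integral>x. x \<partial>\<mu>) = 0"
  shows "(\<lambda>d. char \<mu> (1 / sqrt (real d)) ^ d) \<longlonglongrightarrow> exp (- (\<integral>x. x\<^sup>2 \<partial>\<mu>) / 2)"
proof -
  interpret \<mu>: real_distribution \<mu> by fact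
  define s where "s = sqrt (\<integral>x. x\<^sup>2 \<partial>\<mu>)"
  have s: "0 \<le> s" "s\<^sup>2 = (\<integral>x. x\<^sup>2 \<partial>\<mu>)"
    by (auto simp: s_def)
  show ?thesis
  proof (cases "s = 0")
    \<comment> \<open>With zero variance there is no normalisation by the standard deviation;
      \<open>\<mu>\<close> is then concentrated at 0 and both sides are 1.\<close>
    case True
    then have "AE x in \<mu>. x\<^sup>2 = 0"
      using integral_nonneg_eq_0_iff_AE[OF int] s by simp
    then have "char \<mu> t = (\<integral>x. 1 \<partial>\<mu>)" for t
      unfolding char_def by (intro integral_cong_AE) auto
    then show ?thesis
      using True s by (simp add: \<mu>.prob_space[simplified])
  next
    case False
    let ?P = "\<Pi>\<^sub>M k\<in>(UNIV::nat set). \<mu>"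
    interpret P: product_prob_space "\<lambda>_::nat. \<mu>" UNIV
      by unfold_locales
    have distr: "distr ?P borel (\<lambda>x. x i) = \<mu>" for i
      using P.PiM_component[of i] by (simp cong: distr_cong)
    have coord [measurable]: "(\<lambda>x. x i) \<in> borel_measurable ?P" for i
      using measurable_component_singleton[of i UNIV "\<lambda>_. \<mu>"] by simp
    have indep: "P.indep_vars (\<lambda>_. borel) (\<lambda>i x. x i) UNIV"
      using indep_vars_PiM_coordinates[of "UNIV :: nat set" "\<lambda>_. \<mu>"] \<mu>.prob_space_axioms
      by (simp add: P.indep_vars_def)
    have E: "(\<integral>x. f (x i) \<partial>?P) = (\<integral>y. f y \<partial>\<mu>)" "integrable ?P (\<lambda>x. f (x i)) = integrable \<mu> f"
      if [measurable]: "f \<in> borel_measurable borel" for f :: "real \<Rightarrow> real" and i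
      using integral_distr[of "\<lambda>x. x i" ?P borel f] integrable_distr_eq[of "\<lambda>x. x i" ?P borel f]
      by (auto simp: distr)
    have "weak_conv_m (\<lambda>n. distr ?P borel (\<lambda>x. (\<Sum>i<n. x i) / sqrt (n * s\<^sup>2))) std_normal_distribution"
    proof (rule P.central_limit_theorem_zero_mean[OF indep])
      show "P.expectation (\<lambda>x. x n) = 0" for n
        using E(1)[of "\<lambda>x. x" n] mean by simp
      then show "P.variance (\<lambda>x. x n) = s\<^sup>2" for n
        using E(1)[of "\<lambda>x. x\<^sup>2" n] s by simp
      show "integrable ?P (\<lambda>x. (x n)\<^sup>2)" for n
        using E(2)[of "\<lambda>x. x\<^sup>2" n] int by simp
    qed (use False s distr in auto)
    \<comment> \<open>The argument \<open>s\<close> cancels the standard deviation in the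
      normalisation and leaves the factor \<open>1 / sqrt n\<close>.\<close>
    then have "(\<lambda>n. char (distr ?P borel (\<lambda>x. (\<Sum>i<n. x i) / sqrt (n * s\<^sup>2))) s)
        \<longlonglongrightarrow> char std_normal_distribution s"
      by (intro levy_continuity1 real_dist_normal_dist) auto
    moreover have "char (distr ?P borel (\<lambda>x. (\<Sum>i<n. x i) / sqrt (n * s\<^sup>2))) s = char \<mu> (1 / sqrt n) ^ n" for n
    proof -
      have "char (distr ?P borel (\<lambda>x. (\<Sum>i<n. x i) / sqrt (n * s\<^sup>2))) s
          = char (distr ?P borel (\<lambda>x. \<Sum>i<n. x i)) (1 / sqrt n)"
        using False s(1) by (simp add: char_def integral_distr real_sqrt_mult)
      also have "\<dots> = (\<Prod>i<n. char (distr ?P borel (\<lambda>x. x i)) (1 / sqrt n))"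
        by (intro P.char_distr_sum P.indep_vars_subset[OF indep]) auto
      finally show ?thesis
        by (simp add: distr)
    qed
    ultimately show ?thesis
      unfolding s(2)[symmetric] by (simp add: char_std_normal_distribution flip: exp_of_real)
  qed
qed

section \<open>Squared distances on the circle\<close>

text \<open>The window from \<open>-y\<close> to \<open>1 - y\<close> is cut at 0 and its left part
  is moved by one period. Periodicity is demanded only on [-1, 0], because the squared circle
  distance, as a function of the difference, has it there but not on the whole line.\<close>

lemma integral_periodic_shift:
  fixes g :: "real \<Rightarrow> real"
  assumes cont: "continuous_on UNIV g"
    and per: "\<And>z. z \<in> {-1..0} \<Longrightarrow> g (1 + z) = g z"
    and y: "y \<in> {0..1}"
  shows "integral {0..1} (\<lambda>x. g (x - y)) = integral {0..1} g"
proof -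
  have int: "g integrable_on {a..b}" for a b
    using cont continuous_on_subset by (blast intro: integrable_continuous_real)
  have "integral {0..1} (\<lambda>x. g (x - y)) = integral {-y..1-y} g"
    using integral_shift_Icc_real[of 0 1 g "-y"] by (simp add: comp_def)
  also have "\<dots> = integral {-y..0} g + integral {0..1-y} g"
    using y int by (intro Henstock_Kurzweil_Integration.integral_combine[symmetric]) auto
  also have "integral {-y..0} g = integral {-y..0} (g \<circ> (+) 1)"
    using y per by (intro Henstock_Kurzweil_Integration.integral_cong) auto
  also have "\<dots> = integral {1-y..1} g"
    using integral_shift_Icc_real[of "-y" 0 g 1] by simp
  also have "integral {1-y..1} g + integral {0..1-y} g = integral {0..1} g"
    using y int by (subst add.commute, intro Henstock_Kurzweil_Integration.integral_combine) auto
  finally show ?thesis .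
qed

lemma integral_unif01:
  fixes f :: "real \<Rightarrow> real"
  assumes "f \<in> borel_measurable borel"
  shows "(\<integral>x. f x \<partial>unif01) = (\<integral>x. indicator {0..1} x * f x \<partial>lborel)"
proof -
  have "unif01 = density lborel (\<lambda>x. ennreal (indicator {0..1} x))"
    unfolding uniform_measure_def by (intro density_cong) (auto simp: indicator_def)
  then show ?thesis
    using assms by (simp add: integral_density)
qed

lemma prob_space_unif01: "prob_space unif01"
  by (rule prob_space_uniform_measure) auto

lemma AE_unif01: "AE x in unif01. x \<in> {0..1}"
  by (rule AE_uniform_measureI) auto

lemma circle_dist_commute: "circle_dist x y = circle_dist y x"
  by (simp add: circle_dist_def abs_minus_commute)

lemma circle_dist_sq_le_1: "x \<in> {0..1} \<Longrightarrow> y \<in> {0..1} \<Longrightarrow> (circle_dist x y)\<^sup>2 \<le> 1"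
  by (rule power_le_one) (auto simp: circle_dist_def)

text \<open>Rotation invariance: the integral over one endpoint is the same constant
  \<open>C\<close> for every position of the other. Averaging over that position, by Fubini,
  identifies \<open>C\<close> with \<open>torus_mean\<close>, whose value is never computed.\<close>

lemma integral_circle_dist_sq:
  assumes "y \<in> {0..1}"
  shows "(\<integral>x. (circle_dist x y)\<^sup>2 \<partial>unif01) = torus_mean"
proof -
  define g :: "real \<Rightarrow> real" where "g z = (min \<bar>z\<bar> (1 - \<bar>z\<bar>))\<^sup>2" for z
  define C where "C = integral {0..1} g"
  have cont [continuous_intros]: "continuous_on A g" for A
    unfolding g_def by (intro continuous_intros)
  have cd: "(circle_dist x y)\<^sup>2 = g (x - y)" for x y
    by (simp add: circle_dist_def g_def)
  have [measurable]: "g \<in> borel_measurable borel"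
    using cont by (rule borel_measurable_continuous_onI)
  have slice: "(\<integral>x. indicator {0..1} x * g (x - y) \<partial>lborel) = C" if y: "y \<in> {0..1}" for y
  proof -
    have "continuous_on {0..1} (\<lambda>x. g (x - y))"
      using cont[of UNIV] by (rule continuous_on_compose2) (auto intro!: continuous_intros)
    then have "set_integrable lborel {0..1} (\<lambda>x. g (x - y))"
      by (intro borel_integrable_atLeastAtMost')
    then have "(\<integral>x. indicator {0..1} x * g (x - y) \<partial>lborel) = integral {0..1} (\<lambda>x. g (x - y))"
      using set_borel_integral_eq_integral(2) by (fastforce simp: set_lebesgue_integral_def)
    also have "\<dots> = C"
      unfolding C_def
      by (rule integral_periodic_shift[OF cont _ y]) (auto simp: g_def min_def)
    finally show ?thesis .
  qed
  have "integrable (lborel \<Otimes>\<^sub>M lborel) (\<lambda>p. indicator ({0..1} \<times> {0..1}) p *\<^sub>R (case p of (x, y) \<Rightarrow> g (x - y)) :: real)"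
    unfolding lborel_prod
    by (intro borel_integrable_compact compact_Times)
       (auto simp: case_prod_unfold intro!: continuous_intros continuous_on_compose2[OF cont[of UNIV]])
  then have "torus_mean = (\<integral>y. (\<integral>x. indicator ({0..1} \<times> {0..1}) (x, y) *\<^sub>R g (x - y) \<partial>lborel) \<partial>lborel)"
    unfolding torus_mean_def set_lebesgue_integral_def lborel_prod[symmetric]
    using lborel_pair.integral_snd[of "\<lambda>x y. indicator ({0..1} \<times> {0..1}) (x, y) *\<^sub>R g (x - y)"]
    by (simp add: cd case_prod_unfold)
  also have "\<dots> = (\<integral>y. indicator {0..1} y * (\<integral>x. indicator {0..1} x * g (x - y) \<partial>lborel) \<partial>lborel)"
    by (intro Bochner_Integration.integral_cong refl)
       (auto simp: indicator_times mult_ac simp flip: integral_mult_right_zero)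
  also have "\<dots> = (\<integral>y. indicator {0..1::real} y * C \<partial>lborel)"
    by (rule Bochner_Integration.integral_cong[OF refl]) (metis slice indicator_simps(2) mult_zero_left)
  also have "\<dots> = C"
    by simp
  finally show ?thesis
    using slice[OF assms] by (subst integral_unif01) (auto simp: cd)
qed

lemma integral_circle_dist_sq_centred:
  assumes "y \<in> {0..1}"
  shows "(\<integral>x. (circle_dist x y)\<^sup>2 - torus_mean \<partial>unif01) = 0"
proof -
  interpret prob_space unif01 by (rule prob_space_unif01)
  have "integrable unif01 (\<lambda>x. (circle_dist x y)\<^sup>2)"
  proof (rule integrable_const_bound)
    show "AE x in unif01. norm ((circle_dist x y)\<^sup>2) \<le> 1"
      using AE_unif01 by eventually_elim (use circle_dist_sq_le_1 assms in simp)
    show "(\<lambda>x. (circle_dist x y)\<^sup>2) \<in> borel_measurable unif01"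
      unfolding circle_dist_def by measurable
  qed
  then show ?thesis
    using integral_circle_dist_sq[OF assms] by (simp add: prob_space[simplified])
qed

section \<open>Deviations of squared edge lengths\<close>

declare One_nat_def [simp del]

text \<open>Here \<open>x\<close> lists a single torus coordinate of all nodes, so it is indexed by
  nodes. An edge is a set; its endpoints are read off as minimum and maximum, and symmetry of
  \<open>circle_dist\<close> makes their order immaterial.\<close>

definition edge_dev :: "nat set \<Rightarrow> (nat \<Rightarrow> real) \<Rightarrow> real" where
  "edge_dev e x = (circle_dist (x (Min e)) (x (Max e)))\<^sup>2 - torus_mean"

text \<open>The law of one torus coordinate of all nodes; \<open>n\<close> counts nodes and is not
  the dimension of the torus.\<close>

abbreviation unif_cube :: "nat \<Rightarrow> (nat \<Rightarrow> real) measure" where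
  "unif_cube n \<equiv> \<Pi>\<^sub>M i\<in>{1..n}. unif01"

lemma edge_dev_pair: "edge_dev {i, j} x = (circle_dist (x i) (x j))\<^sup>2 - torus_mean"
  by (cases "i \<le> j") (auto simp: edge_dev_def circle_dist_commute[of "x i" "x j"] min_def max_def)

lemma node_pairsE:
  assumes "e \<in> node_pairs n"
  obtains i j where "e = {i, j}" "i \<noteq> j" "i \<in> {1..n}" "j \<in> {1..n}"
  using assms by (auto simp: node_pairs_def card_2_iff)

lemma edge_dev_cong:
  assumes "e \<in> node_pairs n" "\<And>i. i \<in> e \<Longrightarrow> x i = y i"
  shows "edge_dev e x = edge_dev e y"
  using assms by (elim node_pairsE) (auto simp: edge_dev_pair)

lemma measurable_edge_dev:
  assumes "e \<in> node_pairs n"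
  shows "edge_dev e \<in> borel_measurable (\<Pi>\<^sub>M i\<in>{1..n}. borel)"
proof -
  obtain i j where ij: "e = {i, j}" "i \<in> {1..n}" "j \<in> {1..n}"
    using assms by (rule node_pairsE)
  then have [measurable]: "(\<lambda>x. x i) \<in> borel_measurable (\<Pi>\<^sub>M i\<in>{1..n}. borel :: real measure)"
    "(\<lambda>x. x j) \<in> borel_measurable (\<Pi>\<^sub>M i\<in>{1..n}. borel :: real measure)"
    by (auto intro: measurable_component_singleton)
  show ?thesis
    unfolding ij edge_dev_pair[abs_def] circle_dist_def by measurable
qed

lemma sets_unif_cube: "sets (unif_cube n) = sets (\<Pi>\<^sub>M i\<in>{1..n}. borel)"
  by (intro sets_PiM_cong) auto

lemma measurable_edge_dev_unif_cube [measurable]: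
  "e \<in> node_pairs n \<Longrightarrow> edge_dev e \<in> borel_measurable (unif_cube n)"
  using measurable_edge_dev by (simp cong: measurable_cong_sets add: sets_unif_cube)

lemma prob_space_unif_cube: "prob_space (unif_cube n)"
  by (rule prob_space_PiM[OF prob_space_unif01])

text \<open>Outside [0, 1] the formula for the circle distance is unbounded, hence a bound almost
  everywhere; it serves integrability only.\<close>

lemma AE_edge_dev_bounded:
  assumes "e \<in> node_pairs n"
  shows "AE x in unif_cube n. \<bar>edge_dev e x\<bar> \<le> 1 + \<bar>torus_mean\<bar>"
proof -
  obtain i j where ij: "e = {i, j}" "i \<in> {1..n}" "j \<in> {1..n}"
    using assms by (rule node_pairsE)
  have coord: "AE x in unif_cube n. x k \<in> {0..1}" if "k \<in> {1..n}" for k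
    using that by (intro AE_PiM_component prob_space_unif01 AE_unif01)
  show ?thesis
    using coord[OF ij(2)] coord[OF ij(3)]
  proof eventually_elim
    case (elim x)
    then have "(circle_dist (x i) (x j))\<^sup>2 \<le> 1"
      by (rule circle_dist_sq_le_1)
    then show ?case
      unfolding ij edge_dev_pair using zero_le_power2[of "circle_dist (x i) (x j)"] by arith
  qed
qed

lemma integrable_edge_dev:
  assumes "e \<in> node_pairs n"
  shows "integrable (unif_cube n) (edge_dev e)"
proof -
  interpret prob_space "unif_cube n" by (rule prob_space_unif_cube)
  show ?thesis
    using assms AE_edge_dev_bounded[OF assms]
    by (intro integrable_const_bound[where B="1 + \<bar>torus_mean\<bar>"]) auto
qed

lemma integrable_edge_dev_mult:
  assumes "e \<in> node_pairs n" "e' \<in> node_pairs n"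
  shows "integrable (unif_cube n) (\<lambda>x. edge_dev e x * edge_dev e' x)"
proof -
  interpret prob_space "unif_cube n" by (rule prob_space_unif_cube)
  show ?thesis
  proof (rule integrable_const_bound)
    show "AE x in unif_cube n. norm (edge_dev e x * edge_dev e' x) \<le> (1 + \<bar>torus_mean\<bar>) * (1 + \<bar>torus_mean\<bar>)"
      using AE_edge_dev_bounded[OF assms(1)] AE_edge_dev_bounded[OF assms(2)]
      by eventually_elim (auto simp: abs_mult intro!: mult_mono)
    show "(\<lambda>x. edge_dev e x * edge_dev e' x) \<in> borel_measurable (unif_cube n)"
      using assms by measurable
  qed
qed

text \<open>Given the position of the other endpoint, an edge length is distributed as the distance
  of a uniform point from a fixed one, whatever that position; hence the lengths of distinct
  edges are uncorrelated even when the edges share a node.\<close>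

lemma integral_edge_dev_mult_eq_0:
  assumes e: "e \<in> node_pairs n" and i: "i \<in> e"
    and f: "\<And>x y. f (x(i := y)) = f x"
    and int: "integrable (unif_cube n) (\<lambda>x. edge_dev e x * f x)"
  shows "(\<integral>x. edge_dev e x * f x \<partial>unif_cube n) = 0"
proof -
  interpret product_sigma_finite "\<lambda>_::nat. unif01"
    by (intro product_sigma_finite.intro prob_space_imp_sigma_finite prob_space_unif01)
  obtain j where ij: "e = {i, j}" "i \<noteq> j" "i \<in> {1..n}" "j \<in> {1..n}"
    using e i by (elim node_pairsE) (auto simp: insert_commute)
  define I where "I = {1..n} - {i}"
  have I: "{1..n} = insert i I" "finite I" "i \<notin> I" "j \<in> I"
    using ij by (auto simp: I_def)
  \<comment> \<open>Fubini with the position of node \<open>i\<close> integrated innermost: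
    \<open>f\<close> does not depend on it, and the deviation averages to 0 for each fixed position
    of \<open>j\<close> in [0, 1].\<close>
  have "(\<integral>x. edge_dev e x * f x \<partial>unif_cube n) =
      (\<integral>x. (\<integral>y. edge_dev e (x(i := y)) * f (x(i := y)) \<partial>unif01) \<partial>(\<Pi>\<^sub>M i\<in>I. unif01))"
    using int unfolding I(1) by (intro product_integral_insert I(2,3))
  also have "\<dots> = 0"
  proof (rule integral_eq_zero_AE)
    have "AE x in \<Pi>\<^sub>M i\<in>I. unif01. x j \<in> {0..1}"
      using I by (intro AE_PiM_component prob_space_unif01 AE_unif01)
    then show "AE x in \<Pi>\<^sub>M i\<in>I. unif01. (\<integral>y. edge_dev e (x(i := y)) * f (x(i := y)) \<partial>unif01) = 0"
    proof eventually_elim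
      case (elim x)
      then show ?case
        using ij integral_circle_dist_sq_centred[of "x j"] by (simp add: edge_dev_pair f)
    qed
  qed
  finally show ?thesis .
qed

section \<open>Moments of the edge deviations\<close>

lemma integral_edge_dev:
  assumes "e \<in> node_pairs n"
  shows "(\<integral>x. edge_dev e x \<partial>unif_cube n) = 0"
  using assms integral_edge_dev_mult_eq_0[of e n _ "\<lambda>_. 1"] integrable_edge_dev[OF assms]
  by (auto elim!: node_pairsE)

lemma integral_edge_dev_mult:
  assumes e: "e \<in> node_pairs n" "e' \<in> node_pairs n" and "e \<noteq> e'"
  shows "(\<integral>x. edge_dev e x * edge_dev e' x \<partial>unif_cube n) = 0"
proof -
  \<comment> \<open>Distinct edges have equal size, so \<open>e\<close> has an endpoint outside
    \<open>e'\<close>; moving it leaves the other factor unchanged.\<close>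
  have "finite e'" "card e = card e'"
    using e by (auto simp: node_pairs_def intro: finite_subset)
  then have "\<not> e \<subseteq> e'"
    using \<open>e \<noteq> e'\<close> card_subset_eq by blast
  then obtain i where "i \<in> e" "i \<notin> e'"
    by blast
  then show ?thesis
    using e by (intro integral_edge_dev_mult_eq_0[where i=i] integrable_edge_dev_mult edge_dev_cong[where n=n]) auto
qed

lemma integral_edge_dev_sq:
  assumes "e \<in> node_pairs n"
  shows "(\<integral>x. edge_dev e x * edge_dev e x \<partial>unif_cube n) = torus_var"
proof -
  interpret prob_space "unif_cube n" by (rule prob_space_unif_cube)
  obtain i j where ij: "e = {i, j}" "i \<noteq> j" "i \<in> {1..n}" "j \<in> {1..n}"
    using assms by (rule node_pairsE)
  have distr: "distr (unif_cube n) borel (\<lambda>x. x k) = unif01" if "k \<in> {1..n}" for k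
    using distr_PiM_component[of "{1..n}" "\<lambda>_. unif01" k] that prob_space_unif01
    by (simp cong: distr_cong)
  have "indep_vars (\<lambda>_. unif01) (\<lambda>i x. x i) {1..n}"
    by (rule indep_vars_PiM_coordinates) (rule prob_space_unif01)
  then have indep: "indep_vars (\<lambda>_. borel) (\<lambda>i x. x i) {1..n}"
    by (simp add: indep_vars_def)
  have "indep_var borel ((\<lambda>f. f i) \<circ> (\<lambda>x. restrict (\<lambda>k. x k) {i}))
      borel ((\<lambda>f. f j) \<circ> (\<lambda>x. restrict (\<lambda>k. x k) {j}))"
    using ij by (intro indep_var_compose[OF indep_var_restrict[OF indep]] measurable_component_singleton) auto
  then have "indep_var borel (\<lambda>x. x i) borel (\<lambda>x. x j)"
    by (simp add: comp_def)
  then have "(\<integral>x. ((circle_dist (x i) (x j))\<^sup>2 - torus_mean)\<^sup>2 \<partial>unif_cube n) = torus_var"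
    using ij by (intro expectation_eq_torus_var distr prob_space_unif_cube)
  then show ?thesis
    by (simp add: ij edge_dev_pair power2_eq_square)
qed

lemma torus_var_nonneg: "0 \<le> torus_var"
  unfolding torus_var_def by (intro integral_nonneg_AE) auto

text \<open>\<open>V\<close> is the contribution of one torus coordinate to a linear combination of
  the edge sums. Its variance has no mixed terms in \<open>u\<close>, and this makes the limiting
  characteristic function factor over the edges.\<close>

lemma edge_dev_combination_moments:
  fixes n :: nat and u :: "nat set \<Rightarrow> real"
  defines "V \<equiv> \<lambda>x. \<Sum>e\<in>node_pairs n. u e * edge_dev e x"
  shows "integrable (unif_cube n) (\<lambda>x. (V x)\<^sup>2)"
    and "(\<integral>x. V x \<partial>unif_cube n) = 0"
    and "(\<integral>x. (V x)\<^sup>2 \<partial>unif_cube n) = torus_var * (\<Sum>e\<in>node_pairs n. (u e)\<^sup>2)"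
proof -
  have sq: "(V x)\<^sup>2 = (\<Sum>e\<in>node_pairs n. \<Sum>e'\<in>node_pairs n. u e * u e' * (edge_dev e x * edge_dev e' x))" for x
    by (simp add: V_def power2_eq_square sum_product mult_ac)
  have int: "integrable (unif_cube n) (\<lambda>x. u e * u e' * (edge_dev e x * edge_dev e' x))"
    if "e \<in> node_pairs n" "e' \<in> node_pairs n" for e e'
    using integrable_edge_dev_mult[OF that] by simp
  show "integrable (unif_cube n) (\<lambda>x. (V x)\<^sup>2)"
    unfolding sq by (intro Bochner_Integration.integrable_sum int)
  show "(\<integral>x. V x \<partial>unif_cube n) = 0"
    unfolding V_def using integrable_edge_dev integral_edge_dev
    by (subst Bochner_Integration.integral_sum) auto
  have "(\<integral>x. (V x)\<^sup>2 \<partial>unif_cube n) = (\<Sum>e\<in>node_pairs n. \<Sum>e'\<in>node_pairs n.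
      u e * u e' * (\<integral>x. edge_dev e x * edge_dev e' x \<partial>unif_cube n))"
    unfolding sq using int
    by (simp add: Bochner_Integration.integral_sum Bochner_Integration.integrable_sum)
  also have "\<dots> = (\<Sum>e\<in>node_pairs n. \<Sum>e'\<in>node_pairs n. if e' = e then torus_var * (u e)\<^sup>2 else 0)"
    by (intro sum.cong refl) (auto simp: integral_edge_dev_mult integral_edge_dev_sq power2_eq_square)
  also have "\<dots> = torus_var * (\<Sum>e\<in>node_pairs n. (u e)\<^sup>2)"
    by (simp add: finite_node_pairs sum_distrib_left)
  finally show "(\<integral>x. (V x)\<^sup>2 \<partial>unif_cube n) = torus_var * (\<Sum>e\<in>node_pairs n. (u e)\<^sup>2)" .
qed

text \<open>Grouping the variables by torus coordinate gives \<open>d\<close> independent blocks,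
  each distributed as \<open>unif_cube n\<close>. By \<open>V_restrict\<close>, \<open>V\<close>
  looks only at the nodes in \<open>{1..n}\<close>, so it takes the same value on a position
  function that is not cut off outside this range.\<close>

lemma (in prob_space) char_coordinate_sums:
  fixes X :: "nat \<Rightarrow> 'a \<Rightarrow> nat \<Rightarrow> real" and V :: "(nat \<Rightarrow> real) \<Rightarrow> real"
  assumes indep: "indep_vars (\<lambda>_. borel) (\<lambda>(i, k) \<omega>. X i \<omega> k) ({1..n} \<times> {1..d})"
    and unif: "\<And>i k. i \<in> {1..n} \<Longrightarrow> k \<in> {1..d} \<Longrightarrow> distr M borel (\<lambda>\<omega>. X i \<omega> k) = unif01"
    and V: "V \<in> borel_measurable (\<Pi>\<^sub>M i\<in>{1..n}. borel)"
    and V_restrict: "\<And>x. V (restrict x {1..n}) = V x"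
  shows "char (distr M borel (\<lambda>\<omega>. \<Sum>k=1..d. V (\<lambda>i. X i \<omega> k))) t = char (distr (unif_cube n) borel V) t ^ d"
proof -
  define Y where "Y p \<omega> = (case p of (i, k) \<Rightarrow> X i \<omega> k)" for p \<omega>
  \<comment> \<open>\<open>K k\<close> indexes the block of coordinate \<open>k\<close>, and
    \<open>r k\<close> renames \<open>(i, k)\<close> to \<open>i\<close>, so that all blocks take
    values in one product space.\<close>
  define K where "K k = {1..n} \<times> {k}" for k :: nat
  define r where "r k f = (\<lambda>i\<in>{1..n}. f (i, k))" for k :: nat and f :: "nat \<times> nat \<Rightarrow> real"
  have Y: "(\<lambda>(i, k) \<omega>. X i \<omega> k) = Y"
    by (auto simp: Y_def fun_eq_iff)
  note indep = indep[unfolded Y]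
  have r: "r k \<in> (\<Pi>\<^sub>M p\<in>K k. borel) \<rightarrow>\<^sub>M (\<Pi>\<^sub>M i\<in>{1..n}. borel)" for k
    unfolding r_def by (intro measurable_restrict measurable_component_singleton) (auto simp: K_def)
  have rY: "V (r k (\<lambda>p\<in>K k. Y p \<omega>)) = V (\<lambda>i. X i \<omega> k)" for k \<omega>
  proof -
    have "r k (\<lambda>p\<in>K k. Y p \<omega>) = restrict (\<lambda>i. X i \<omega> k) {1..n}"
      by (auto simp: r_def K_def Y_def)
    then show ?thesis
      by (simp add: V_restrict)
  qed
  have "indep_vars (\<lambda>k. \<Pi>\<^sub>M p\<in>K k. borel) (\<lambda>k \<omega>. \<lambda>p\<in>K k. Y p \<omega>) {1..d}"
    by (rule indep_vars_restrict[OF indep]) (auto simp: K_def disjoint_family_on_def)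
  then have "indep_vars (\<lambda>_. borel) (\<lambda>k \<omega>. V (r k (\<lambda>p\<in>K k. Y p \<omega>))) {1..d}"
    by (rule indep_vars_compose2) (rule measurable_compose[OF r V])
  then have "char (distr M borel (\<lambda>\<omega>. \<Sum>k=1..d. V (\<lambda>i. X i \<omega> k))) t =
      (\<Prod>k=1..d. char (distr M borel (\<lambda>\<omega>. V (\<lambda>i. X i \<omega> k))) t)"
    unfolding rY by (rule char_distr_sum)
  also have "\<dots> = (\<Prod>k=1..d. char (distr (unif_cube n) borel V) t)"
  proof (intro prod.cong refl arg_cong2[where f=char])
    fix k assume k: "k \<in> {1..d}"
    show "distr M borel (\<lambda>\<omega>. V (\<lambda>i. X i \<omega> k)) = distr (unif_cube n) borel V"
    proof (cases "n = 0")
      \<comment> \<open>Without nodes the blocks are empty and \<open>V\<close> is constant, so both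
        laws are the same point mass.\<close>
      case True
      then have "V x = V (\<lambda>_. undefined)" for x
        using V_restrict[of x] by (simp add: restrict_def)
      then obtain c where "V = (\<lambda>_. c)"
        by (blast intro: ext)
      then show ?thesis
        using prob_space.distr_const[OF prob_space_unif_cube[of n], of c borel] distr_const[of c borel] by simp
    next
      case False
      have Kk: "K k \<noteq> {}" "K k \<subseteq> {1..n} \<times> {1..d}"
        using False k by (auto simp: K_def)
      have rv [measurable]: "Y p \<in> borel_measurable M" if "p \<in> K k" for p
        using indep that Kk by (auto simp: indep_vars_def)
      have joint: "distr M (\<Pi>\<^sub>M p\<in>K k. borel) (\<lambda>\<omega>. \<lambda>p\<in>K k. Y p \<omega>) = (\<Pi>\<^sub>M p\<in>K k. unif01)"
      proof -
        have "distr M (\<Pi>\<^sub>M p\<in>K k. borel) (\<lambda>\<omega>. \<lambda>p\<in>K k. Y p \<omega>) = (\<Pi>\<^sub>M p\<in>K k. distr M borel (Y p))"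
          using indep_vars_subset[OF indep Kk(2)] Kk(1) rv by (subst (asm) indep_vars_iff_distr_eq_PiM') auto
        also have "\<dots> = (\<Pi>\<^sub>M p\<in>K k. unif01)"
          using unif k by (intro PiM_cong) (auto simp: K_def Y_def[abs_def])
        finally show ?thesis .
      qed
      have r': "r k \<in> (\<Pi>\<^sub>M p\<in>K k. unif01) \<rightarrow>\<^sub>M unif_cube n"
        unfolding r_def by (intro measurable_restrict measurable_component_singleton) (auto simp: K_def)
      have V': "V \<in> borel_measurable (unif_cube n)"
        using V by (simp cong: measurable_cong_sets add: sets_unif_cube)
      have "distr M borel (\<lambda>\<omega>. V (\<lambda>i. X i \<omega> k)) =
          distr (distr M (\<Pi>\<^sub>M p\<in>K k. borel) (\<lambda>\<omega>. \<lambda>p\<in>K k. Y p \<omega>)) borel (V \<circ> r k)"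
        using measurable_comp[OF r V] by (subst distr_distr) (auto simp: comp_def rY)
      also have "\<dots> = distr (distr (\<Pi>\<^sub>M p\<in>K k. unif01) (unif_cube n) (r k)) borel V"
        unfolding joint using r' V' by (subst distr_distr) auto
      also have "distr (\<Pi>\<^sub>M p\<in>K k. unif01) (unif_cube n) (r k) = unif_cube n"
        using distr_PiM_reindex[of "K k" "\<lambda>_. unif01" "\<lambda>i. (i, k)" "{1..n}"] prob_space_unif01
        by (auto simp: r_def[abs_def] K_def inj_on_def)
      finally show ?thesis .
    qed
  qed
  finally show ?thesis
    by simp
qed

text \<open>Since \<open>g\<close> consists of node pairs, generating it prescribes the outcome of
  each coin flip, which makes the event a box.\<close>

lemma measure_erdos_renyi:
  assumes p: "0 \<le> p" "p \<le> 1" and g: "g \<in> labelled_graphs n"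
  shows "measure (erdos_renyi n p) {g} = (\<Prod>e\<in>node_pairs n. if e \<in> g then p else 1 - p)"
proof -
  have "(\<lambda>f. {e \<in> node_pairs n. f e}) -` {g} = Pi (node_pairs n) (\<lambda>e. {e \<in> g})"
    using g by (auto simp: labelled_graphs_def)
  then have "measure (erdos_renyi n p) {g} =
      (\<Prod>e\<in>node_pairs n. measure (bernoulli_pmf p) {e \<in> g})"
    by (simp add: erdos_renyi_def measure_Pi_pmf_Pi finite_node_pairs)
  also have "\<dots> = (\<Prod>e\<in>node_pairs n. if e \<in> g then p else 1 - p)"
    using p by (intro prod.cong refl) (auto simp: measure_pmf_single)
  finally show ?thesis .
qed

section \<open>Convergence of the graph ensembles\<close>

text \<open>An unordered pair may enter the graph through either orientation; symmetry of the
  distance on it makes the two conditions agree.\<close>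

lemma in_geometric_graph_iff:
  assumes "i \<noteq> j" "i \<in> {1..n}" "j \<in> {1..n}" and sym: "\<rho> (x j) (x i) = \<rho> (x i) (x j)"
  shows "{i, j} \<in> geometric_graph n \<rho> r x \<longleftrightarrow> \<rho> (x i) (x j) \<le> r"
proof
  assume "{i, j} \<in> geometric_graph n \<rho> r x"
  then obtain i' j' where "{i, j} = {i', j'}" "\<rho> (x i') (x j') \<le> r"
    by (auto simp: geometric_graph_def)
  then show "\<rho> (x i) (x j) \<le> r"
    using sym by (auto simp: doubleton_eq_iff)
next
  assume "\<rho> (x i) (x j) \<le> r"
  then show "{i, j} \<in> geometric_graph n \<rho> r x"
    using assms by (auto simp: geometric_graph_def)
qed

lemma edge_in_torus_graph_iff:
  assumes e: "e \<in> node_pairs n" and r: "0 \<le> r" and d: "0 < d"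
  shows "e \<in> geometric_graph n (torus_dist d) r x \<longleftrightarrow>
    (\<Sum>k=1..d. edge_dev e (\<lambda>i. x i k)) / sqrt d \<le> r\<^sup>2 / sqrt d - torus_mean * sqrt d"
proof -
  obtain i j where ij: "e = {i, j}" "i \<noteq> j" "i \<in> {1..n}" "j \<in> {1..n}"
    using e by (rule node_pairsE)
  let ?Q = "\<Sum>k=1..d. (circle_dist (x i k) (x j k))\<^sup>2"
  have sqrt_d: "r\<^sup>2 / sqrt d - torus_mean * sqrt d = (r\<^sup>2 - d * torus_mean) / sqrt d"
    by (simp add: diff_divide_distrib real_div_sqrt flip: times_divide_eq_left)
  have "torus_dist d (x j) (x i) = torus_dist d (x i) (x j)"
    by (simp add: torus_dist_def circle_dist_commute)
  then have "e \<in> geometric_graph n (torus_dist d) r x \<longleftrightarrow> torus_dist d (x i) (x j) \<le> r"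
    using in_geometric_graph_iff[OF ij(2-4)] ij(1) by simp
  also have "\<dots> \<longleftrightarrow> ?Q \<le> r\<^sup>2"
    unfolding torus_dist_def using r by (metis real_sqrt_le_iff real_sqrt_unique)
  also have "\<dots> \<longleftrightarrow> (\<Sum>k=1..d. edge_dev e (\<lambda>i. x i k)) \<le> r\<^sup>2 - d * torus_mean"
    by (simp add: ij edge_dev_pair sum_subtractf)
  also have "\<dots> \<longleftrightarrow> (\<Sum>k=1..d. edge_dev e (\<lambda>i. x i k)) / sqrt d \<le> r\<^sup>2 / sqrt d - torus_mean * sqrt d"
    unfolding sqrt_d using d by (simp add: divide_le_cancel)
  finally show ?thesis .
qed

text \<open>\<open>\<nu>\<close> is the law of \<open>Z\<close>, rebuilt from the standard normal so
  that its characteristic function comes from the standard one. It has no atoms, hence the open and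
  the closed half-line have equal probability.\<close>

lemma scaled_std_normal:
  fixes s t :: real
  assumes s: "0 < s" and N: "prob_space N"
    and Z: "distributed N lborel Z (normal_density 0 s)"
  defines "\<nu> \<equiv> distr std_normal_distribution borel (\<lambda>x. s * x)"
  shows "real_distribution \<nu>"
    and "char \<nu> u = exp (- (s\<^sup>2 * u\<^sup>2) / 2)"
    and "measure \<nu> {t} = 0"
    and "measure N {\<omega> \<in> space N. Z \<omega> < t} = measure \<nu> {..t}"
proof -
  interpret N: prob_space N by (rule N)
  interpret std: real_distribution std_normal_distribution
    by (rule real_dist_normal_dist)
  show \<nu>: "real_distribution \<nu>"
    unfolding \<nu>_def by (rule std.real_distribution_distr) simp
  interpret \<nu>: real_distribution \<nu> by (rule \<nu>)
  have "char \<nu> u = char std_normal_distribution (s * u)"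
    by (simp add: \<nu>_def char_def integral_distr mult_ac)
  then show "char \<nu> u = exp (- (s\<^sup>2 * u\<^sup>2) / 2)"
    by (simp add: char_std_normal_distribution power_mult_distrib)
  have "emeasure std_normal_distribution {t / s} = 0"
    by (simp add: emeasure_density nn_integral_indicator_singleton)
  moreover have "(\<lambda>x. s * x) -` {t} = {t / s}"
    using s by (auto simp: field_simps)
  ultimately show null: "measure \<nu> {t} = 0"
    by (simp add: \<nu>_def measure_def emeasure_distr)
  have Z' [measurable]: "Z \<in> borel_measurable N"
    using Z by (simp add: distributed_def)
  have "distributed N lborel (\<lambda>\<omega>. Z \<omega> / s) std_normal_density"
    using N.normal_standard_normal_convert[OF s, of Z 0] Z by simp
  then have "distr N borel (\<lambda>\<omega>. Z \<omega> / s) = std_normal_distribution"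
    by (simp add: distributed_def cong: distr_cong)
  then have "\<nu> = distr (distr N borel (\<lambda>\<omega>. Z \<omega> / s)) borel (\<lambda>x. s * x)"
    by (simp only: \<nu>_def)
  also have "\<dots> = distr N borel Z"
    using s by (subst distr_distr) (auto simp: comp_def)
  finally have "\<nu> = distr N borel Z" .
  then have "measure N {\<omega> \<in> space N. Z \<omega> < t} = measure \<nu> {..<t}"
    by (simp add: measure_distr vimage_def Int_def conj_commute)
  also have "\<dots> = measure \<nu> ({..<t} \<union> {t})"
    using null by (subst \<nu>.finite_measure_Union) auto
  also have "{..<t} \<union> {t} = {..t}"
    by auto
  finally show "measure N {\<omega> \<in> space N. Z \<omega> < t} = measure \<nu> {..t}" .
qed

text \<open>The deterministic shift \<open>a d\<close> contributes only a phase tending to 1. The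
  remaining factor is a power as in \<open>char_power_tendsto\<close>, for the law of the
  contribution of one coordinate.\<close>

lemma cf_scaled_edge_sums_tendsto:
  fixes M :: "nat \<Rightarrow> 'a measure" and X :: "nat \<Rightarrow> nat \<Rightarrow> 'a \<Rightarrow> nat \<Rightarrow> real"
  assumes M: "\<And>d. d \<ge> 1 \<Longrightarrow> prob_space (M d)"
    and indep: "\<And>d. d \<ge> 1 \<Longrightarrow>
      prob_space.indep_vars (M d) (\<lambda>_. borel) (\<lambda>(i, k) \<omega>. X d i \<omega> k) ({1..n} \<times> {1..d})"
    and unif: "\<And>d i k. d \<ge> 1 \<Longrightarrow> i \<in> {1..n} \<Longrightarrow> k \<in> {1..d} \<Longrightarrow>
      distr (M d) borel (\<lambda>\<omega>. X d i \<omega> k) = unif01"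
    and a: "a \<longlonglongrightarrow> 0"
  shows "(\<lambda>d. \<integral>\<omega>. iexp (\<Sum>e\<in>node_pairs n.
        u e * ((\<Sum>k=1..d. edge_dev e (\<lambda>i. X d i \<omega> k)) / sqrt d - a d)) \<partial>M d)
      \<longlonglongrightarrow> exp (- (torus_var * (\<Sum>e\<in>node_pairs n. (u e)\<^sup>2)) / 2)"
proof -
  define V where "V x = (\<Sum>e\<in>node_pairs n. u e * edge_dev e x)" for x
  define \<mu> where "\<mu> = distr (unif_cube n) borel V"
  have V: "V \<in> borel_measurable (\<Pi>\<^sub>M i\<in>{1..n}. borel)"
    unfolding V_def by (intro borel_measurable_sum borel_measurable_times borel_measurable_const measurable_edge_dev)
  then have V' [measurable]: "V \<in> borel_measurable (unif_cube n)"
    by (simp cong: measurable_cong_sets add: sets_unif_cube)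
  have V_restrict: "V (restrict x {1..n}) = V x" for x
    unfolding V_def
    by (intro sum.cong refl arg_cong2[where f="(*)"] edge_dev_cong[where n=n]) (auto simp: node_pairs_def)
  have "(\<lambda>d. char \<mu> (1 / sqrt d) ^ d) \<longlonglongrightarrow> exp (- (\<integral>x. x\<^sup>2 \<partial>\<mu>) / 2)"
    using edge_dev_combination_moments[of n u] unfolding V_def[symmetric]
    by (intro char_power_tendsto)
       (auto simp: \<mu>_def integrable_distr_eq integral_distr
         intro!: prob_space.real_distribution_distr prob_space_unif_cube)
  moreover have "(\<integral>x. x\<^sup>2 \<partial>\<mu>) = torus_var * (\<Sum>e\<in>node_pairs n. (u e)\<^sup>2)"
    using edge_dev_combination_moments(3)[of n u] unfolding V_def[symmetric]
    by (simp add: \<mu>_def integral_distr)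
  ultimately have lim: "(\<lambda>d. char \<mu> (1 / sqrt d) ^ d)
      \<longlonglongrightarrow> exp (- (torus_var * (\<Sum>e\<in>node_pairs n. (u e)\<^sup>2)) / 2)"
    by simp
  have "(\<lambda>d. iexp (- a d * (\<Sum>e\<in>node_pairs n. u e))) \<longlonglongrightarrow> iexp (- 0 * (\<Sum>e\<in>node_pairs n. u e))"
    by (intro tendsto_intros a)
  from tendsto_mult[OF this lim]
  have "(\<lambda>d. iexp (- a d * (\<Sum>e\<in>node_pairs n. u e)) * char \<mu> (1 / sqrt d) ^ d)
      \<longlonglongrightarrow> exp (- (torus_var * (\<Sum>e\<in>node_pairs n. (u e)\<^sup>2)) / 2)"
    by simp
  \<comment> \<open>Nothing is assumed about dimension 0, so the identity is claimed from
    \<open>d = 1\<close> on.\<close>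
  moreover have "\<forall>\<^sub>F d in sequentially. iexp (- a d * (\<Sum>e\<in>node_pairs n. u e)) * char \<mu> (1 / sqrt d) ^ d =
      (\<integral>\<omega>. iexp (\<Sum>e\<in>node_pairs n.
        u e * ((\<Sum>k=1..d. edge_dev e (\<lambda>i. X d i \<omega> k)) / sqrt d - a d)) \<partial>M d)"
  proof (rule eventually_sequentiallyI)
    fix d :: nat assume d: "1 \<le> d"
    interpret prob_space "M d" by (rule M[OF d])
    let ?T = "\<lambda>\<omega>. \<Sum>k=1..d. V (\<lambda>i. X d i \<omega> k)"
    have split: "(\<Sum>e\<in>node_pairs n. u e * ((\<Sum>k=1..d. edge_dev e (\<lambda>i. X d i \<omega> k)) / sqrt d - a d))
        = - a d * (\<Sum>e\<in>node_pairs n. u e) + 1 / sqrt d * ?T \<omega>" for \<omega>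
      unfolding V_def
      by (subst sum.swap)
        (simp add: right_diff_distrib sum_subtractf sum_distrib_left sum_divide_distrib sum_negf mult_ac)
    have [measurable]: "?T \<in> borel_measurable (M d)"
    proof (intro borel_measurable_sum)
      fix k assume "k \<in> {1..d}"
      then have "(\<lambda>\<omega>. \<lambda>i\<in>{1..n}. X d i \<omega> k) \<in> M d \<rightarrow>\<^sub>M (\<Pi>\<^sub>M i\<in>{1..n}. borel)"
        using indep[OF d] by (intro measurable_restrict) (auto simp: indep_vars_def)
      from measurable_compose[OF this V] show "(\<lambda>\<omega>. V (\<lambda>i. X d i \<omega> k)) \<in> borel_measurable (M d)"
        by (simp only: V_restrict)
    qed
    have "(\<integral>\<omega>. iexp (1 / sqrt d * ?T \<omega>) \<partial>M d) = char \<mu> (1 / sqrt d) ^ d"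
      using char_coordinate_sums[OF indep[OF d] unif[OF d] V V_restrict, of "1 / sqrt d"]
      by (simp add: \<mu>_def char_def integral_distr)
    then show "iexp (- a d * (\<Sum>e\<in>node_pairs n. u e)) * char \<mu> (1 / sqrt d) ^ d =
      (\<integral>\<omega>. iexp (\<Sum>e\<in>node_pairs n.
        u e * ((\<Sum>k=1..d. edge_dev e (\<lambda>i. X d i \<omega> k)) / sqrt d - a d)) \<partial>M d)"
      unfolding split of_real_add distrib_left exp_add by simp
  qed
  ultimately show ?thesis
    by (rule Lim_transform_eventually)
qed

theorem theorem1:
  fixes n :: nat
    and r0 :: "nat \<Rightarrow> real"
    and t :: real
    and M :: "nat \<Rightarrow> 'a measure"
    and X :: "nat \<Rightarrow> nat \<Rightarrow> 'a \<Rightarrow> nat \<Rightarrow> real"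
    and N :: "'b measure"
    and Z :: "'b \<Rightarrow> real"
  assumes "\<And>d. d \<ge> 1 \<Longrightarrow> prob_space (M d)"
    and "\<And>d. d \<ge> 1 \<Longrightarrow>
      prob_space.indep_vars (M d) (\<lambda>_. borel) (\<lambda>(i, k) \<omega>. X d i \<omega> k) ({1..n} \<times> {1..d})"
    and "\<And>d i k. d \<ge> 1 \<Longrightarrow> i \<in> {1..n} \<Longrightarrow> k \<in> {1..d} \<Longrightarrow>
      distr (M d) borel (\<lambda>\<omega>. X d i \<omega> k) = uniform_measure lborel {0..1}"
    and "\<And>d. d \<ge> 1 \<Longrightarrow> r0 d \<ge> 0"
    and "(\<lambda>d. (r0 d)\<^sup>2 / sqrt (real d) - torus_mean * sqrt (real d)) \<longlonglongrightarrow> t"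
    and "prob_space N"
    and "distributed N lborel Z (\<lambda>z. ennreal (normal_density 0 (sqrt torus_var) z))"
  shows "ensembles_converge n
    (\<lambda>d. hard_rgg n (torus_dist d) (r0 d) (M d) (X d))
    (measure_pmf (erdos_renyi n (measure N {\<omega> \<in> space N. Z \<omega> < t})))"
  unfolding ensembles_converge_def
proof
  fix g assume g: "g \<in> labelled_graphs n"
  define s where "s = sqrt torus_var"
  \<comment> \<open>Positivity of the variance is drawn from the existence of \<open>Z\<close>:
    division by zero being 0, \<open>normal_density\<close> with standard deviation 0 vanishes
    identically, and the law of \<open>Z\<close> would have mass 0.\<close>
  have "s \<noteq> 0"
  proof
    assume "s = 0"
    then have "distr N lborel Z = density lborel (\<lambda>_. 0)"
      using distributed_distr_eq_density[OF assms(7)] by (simp add: s_def normal_density_def)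
    then have "prob_space (density lborel (\<lambda>_. 0) :: real measure)"
      using prob_space.prob_space_distr[OF assms(6) distributed_measurable[OF assms(7)]] by simp
    then show False
      using prob_space.emeasure_space_1 by (fastforce simp: emeasure_density)
  qed
  then have s: "0 < s" "s\<^sup>2 = torus_var"
    using torus_var_nonneg by (auto simp: s_def less_le)
  define \<nu> where "\<nu> = distr std_normal_distribution borel (\<lambda>x. s * x)"
  note \<nu> = scaled_std_normal[OF s(1) assms(6) assms(7)[folded s_def], folded \<nu>_def]
  interpret \<nu>: real_distribution \<nu> by (rule \<nu>(1))
  define p where "p = measure N {\<omega> \<in> space N. Z \<omega> < t}"
  \<comment> \<open>\<open>a d\<close> is the signed error of the threshold. Subtracting it from the
    edge sums puts the threshold at exactly \<open>t\<close> for every \<open>d\<close>, so the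
    events in \<open>B\<close> do not vary with \<open>d\<close>.\<close>
  define a where "a d = (r0 d)\<^sup>2 / sqrt (real d) - torus_mean * sqrt (real d) - t" for d
  define S where "S d e \<omega> = (\<Sum>k=1..d. edge_dev e (\<lambda>i. X d i \<omega> k)) / sqrt d - a d" for d e \<omega>
  define B where "B e = (if e \<in> g then {..t} else {t<..})" for e :: "nat set"
  have a0: "a \<longlonglongrightarrow> 0"
    unfolding a_def using tendsto_diff[OF assms(5) tendsto_const[of t]] by simp
  have coord: "(\<lambda>\<omega>. X d i \<omega> k) \<in> borel_measurable (M d)"
    if "d \<ge> 1" "i \<in> {1..n}" "k \<in> {1..d}" for d i k
    using assms(2)[OF that(1)] that(2,3) unfolding prob_space.indep_vars_def[OF assms(1)[OF that(1)]] by auto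
  have S_meas: "S d e \<in> borel_measurable (M d)" if d: "d \<ge> 1" and e: "e \<in> node_pairs n" for d e
  proof -
    obtain i j where ij: "e = {i, j}" "i \<in> {1..n}" "j \<in> {1..n}"
      using e by (rule node_pairsE)
    have [measurable]: "(\<lambda>\<omega>. X d i \<omega> k) \<in> borel_measurable (M d)"
      "(\<lambda>\<omega>. X d j \<omega> k) \<in> borel_measurable (M d)" if "k \<in> {1..d}" for k
      using coord[OF d] ij that by auto
    show ?thesis
      unfolding S_def[abs_def] ij edge_dev_pair circle_dist_def by measurable
  qed
  have graph: "measure (hard_rgg n (torus_dist d) (r0 d) (M d) (X d)) {g} =
      measure (M d) {\<omega> \<in> space (M d). \<forall>e\<in>node_pairs n. S d e \<omega> \<in> B e}" if d: "d \<ge> 1" for d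
  proof -
    let ?G = "\<lambda>\<omega>. geometric_graph n (torus_dist d) (r0 d) (\<lambda>i. X d i \<omega>)"
    have "?G \<in> M d \<rightarrow>\<^sub>M count_space (labelled_graphs n)"
    proof (rule measurable_geometric_graph)
      fix i j assume "i \<in> {1..n}" "j \<in> {1..n}"
      then have [measurable]: "(\<lambda>\<omega>. X d i \<omega> k) \<in> borel_measurable (M d)"
        "(\<lambda>\<omega>. X d j \<omega> k) \<in> borel_measurable (M d)" if "k \<in> {1..d}" for k
        using coord[OF d] that by auto
      show "(\<lambda>\<omega>. torus_dist d (X d i \<omega>) (X d j \<omega>)) \<in> borel_measurable (M d)"
        unfolding torus_dist_def circle_dist_def by measurable
    qed
    then have "measure (hard_rgg n (torus_dist d) (r0 d) (M d) (X d)) {g} = measure (M d) (?G -` {g} \<inter> space (M d))"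
      unfolding hard_rgg_def using g by (subst measure_distr) auto
    also have "?G -` {g} \<inter> space (M d) = {\<omega> \<in> space (M d). \<forall>e\<in>node_pairs n. S d e \<omega> \<in> B e}"
    proof -
      have "?G \<omega> = g \<longleftrightarrow> (\<forall>e\<in>node_pairs n. e \<in> ?G \<omega> \<longleftrightarrow> e \<in> g)" for \<omega>
        using geometric_graph_in_labelled_graphs[of n "torus_dist d" "r0 d" "\<lambda>i. X d i \<omega>"] g
        unfolding labelled_graphs_def by blast
      moreover have "(e \<in> ?G \<omega> \<longleftrightarrow> e \<in> g) \<longleftrightarrow> S d e \<omega> \<in> B e" if "e \<in> node_pairs n" for e \<omega>
      proof -
        have "e \<in> ?G \<omega> \<longleftrightarrow> S d e \<omega> \<le> t"
          unfolding S_def a_def using d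
          by (subst edge_in_torus_graph_iff[OF that assms(4)[OF d]]) (simp, rule iffI, linarith+)
        then show ?thesis
          by (auto simp: B_def)
      qed
      ultimately show ?thesis
        by auto
    qed
    finally show ?thesis .
  qed
  \<comment> \<open>The index is shifted because the joint limit needs a probability space at every
    index, while the hypotheses start at dimension 1.\<close>
  have "(\<lambda>d. measure (M (Suc d)) {\<omega> \<in> space (M (Suc d)). \<forall>e\<in>node_pairs n. S (Suc d) e \<omega> \<in> B e})
      \<longlonglongrightarrow> (\<Prod>e\<in>node_pairs n. measure \<nu> (B e))"
  proof (rule joint_prob_tendsto)
    show "(\<lambda>d. \<integral>\<omega>. iexp (\<Sum>e\<in>node_pairs n. u e * S (Suc d) e \<omega>) \<partial>M (Suc d))
        \<longlonglongrightarrow> (\<Prod>e\<in>node_pairs n. char \<nu> (u e))" for u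
    proof -
      have "(\<Prod>e\<in>node_pairs n. char \<nu> (u e)) = exp (- (torus_var * (\<Sum>e\<in>node_pairs n. (u e)\<^sup>2)) / 2)"
        unfolding \<nu>(2) s(2)
        by (simp add: finite_node_pairs exp_sum sum_distrib_left sum_divide_distrib flip: sum_negf)
      then show ?thesis
        using LIMSEQ_Suc[OF cf_scaled_edge_sums_tendsto[OF assms(1-3) a0, of u]]
        by (simp only: S_def)
    qed
    show "measure \<nu> (frontier (B e)) = 0" for e
    proof -
      have "frontier {..t} = {t}" "frontier {t<..} = {t}"
        by (auto simp: frontier_def interior_open)
      then show ?thesis
        by (simp add: B_def \<nu>(3))
    qed
  qed (use assms(1) S_meas finite_node_pairs \<nu>(1) in \<open>auto simp: B_def\<close>)
  then have "(\<lambda>d. measure (hard_rgg n (torus_dist d) (r0 d) (M d) (X d)) {g})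
      \<longlonglongrightarrow> (\<Prod>e\<in>node_pairs n. measure \<nu> (B e))"
    by (subst filterlim_sequentially_Suc[symmetric]) (simp add: graph)
  moreover have "measure \<nu> (B e) = (if e \<in> g then p else 1 - p)" for e
  proof -
    have "measure \<nu> {t<..} = 1 - measure \<nu> {..t}"
      using \<nu>.prob_compl[of "{..t}"] by (simp add: Compl_eq_Diff_UNIV[symmetric] flip: Compl_atMost)
    then show ?thesis
      by (simp add: B_def p_def \<nu>(4))
  qed
  moreover have "0 \<le> p" "p \<le> 1"
    unfolding p_def using prob_space.prob_le_1[OF assms(6)] by auto
  ultimately show "(\<lambda>d. measure (hard_rgg n (torus_dist d) (r0 d) (M d) (X d)) {g})
      \<longlonglongrightarrow> measure (measure_pmf (erdos_renyi n (measure N {\<omega> \<in> space N. Z \<omega> < t}))) {g}"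
    unfolding p_def[symmetric] by (simp add: measure_erdos_renyi[OF _ _ g])
qed

end
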